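(* Let $b$ be a prime, $m\in\mathbb{N}$, $N=b^m$, $s\in\mathbb{N}$, $\alpha>1$, let $\boldsymbol{\gamma}=(\gamma_{\mathfrak{u}})_{\mathfrak{u}\subseteq[s]}$ be positive weights with $\gamma_\emptyset=1$, and let $w_1\le w_2\le\cdots\le w_s$ be non-negative integers. Let $\boldsymbol{z}=(Y_1z_1,\ldots,Y_sz_s)\in\mathbb{Z}^s$, with $Y_j=b^{w_j}$, be constructed by the reduced CBC construction (described in the context). Then for every $d\in[s]$ and every $\lambda\in(1/\alpha,1]$, $$e_{N,d}^2\big((Y_1z_1,\ldots,Y_dz_d)\big)\le\left(\sum_{\emptyset\neq\mathfrak{u}\subseteq[d]}\gamma_{\mathfrak{u}}^{\lambda}\,\frac{2(2\zeta(\alpha\lambda))^{|\mathfrak{u}|}}{b^{\max\{0,\,m-\max_{j\in\mathfrak{u}}w_j\}}}\right)^{1/\lambda}.$$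
   Context: Notation: $[d]=\{1,\ldots,d\}$, $\mathbb{Z}_*=\mathbb{Z}\setminus\{0\}$, $\zeta(x)=\sum_{n\ge1}n^{-x}$ for $x>1$. For a vector $\boldsymbol{x}$, $\boldsymbol{x}_{\mathfrak{u}}=(x_j)_{j\in\mathfrak{u}}$. Weighted Korobov space: for $d\in\mathbb{N}$, $\mathcal{H}(K_{d,\alpha,\boldsymbol{\gamma}})$ is the reproducing kernel Hilbert space of functions on $[0,1]^d$ with kernel $$K_{d,\alpha,\boldsymbol{\gamma}}(\boldsymbol{x},\boldsymbol{y})=1+\sum_{\emptyset\ne\mathfrak{u}\subseteq[d]}\gamma_{\mathfrak{u}}\sum_{\boldsymbol{h}_{\mathfrak{u}}\in\mathbb{Z}_*^{|\mathfrak{u}|}}\frac{\exp(2\pi\mathrm{i}\,\boldsymbol{h}_{\mathfrak{u}}\cdot(\boldsymbol{x}_{\mathfrak{u}}-\boldsymbol{y}_{\mathfrak{u}}))}{\prod_{j\in\mathfrak{u}}|h_j|^{\alpha}}.$$ Worst-case error: for $\boldsymbol{z}\in\mathbb{Z}^d$, $e_{N,d}(\boldsymbol{z})=e_{N,d,\alpha,\boldsymbol{\gamma}}(\boldsymbol{z})$ is the worst-case error of the lattice rule generated by $\boldsymbol{z}$, i.e. the supremum over all $f$ in the unit ball of $\mathcal{H}(K_{d,\alpha,\boldsymbol{\gamma}})$ of $\left|\int_{[0,1]^d}f(\boldsymbol{x})\,\mathrm{d}\boldsymbol{x}-\frac1N\sum_{k=0}^{N-1}f(\{\frac{k}{N}\boldsymbol{z}\})\right|$,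 where $\{\cdot\}$ is the componentwise fractional part. It is known that $$e_{N,d}^2(\boldsymbol{z})=\sum_{\emptyset\ne\mathfrak{u}\subseteq[d]}\gamma_{\mathfrak{u}}\sum_{\boldsymbol{h}_{\mathfrak{u}}\in\mathcal{D}_{\mathfrak{u}}}\prod_{j\in\mathfrak{u}}|h_j|^{-\alpha},\qquad \mathcal{D}_{\mathfrak{u}}=\{\boldsymbol{h}_{\mathfrak{u}}\in\mathbb{Z}_*^{|\mathfrak{u}|}:\boldsymbol{h}_{\mathfrak{u}}\cdot\boldsymbol{z}_{\mathfrak{u}}\equiv0\pmod N\}.$$ Reduced CBC construction: put $\mathcal{Z}_{N,w_j}=\{z\in\{1,2,\ldots,b^{m-w_j}-1\}:\gcd(z,N)=1\}$ if $w_j<m$ and $\mathcal{Z}_{N,w_j}=\{1\}$ if $w_j\ge m$; $Y_j=b^{w_j}$. Set $z_1=1$. For $d=1,\ldots,s-1$ successively, given $z_1,\ldots,z_d$, choose $z_{d+1}\in\mathcal{Z}_{N,w_{d+1}}$ minimizing $e_{N,d+1}^2((Y_1z_1,\ldots,Y_dz_d,Y_{d+1}z_{d+1}))$ as a function of $z_{d+1}$. The output is $\boldsymbol{z}=(Y_1z_1,\ldots,Y_sz_s)$. *)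

theory Defs
  imports "HOL-Analysis.Analysis"
begin

text \<open>Functions on a set \<open>X\<close> are represented by functions on the whole type that vanish
  outside \<open>X\<close>. The inner product is linear in its first argument.\<close>

locale function_hilbert_space =
  fixes X :: "'a set"
    and H :: "('a \<Rightarrow> complex) set"
    and ip :: "('a \<Rightarrow> complex) \<Rightarrow> ('a \<Rightarrow> complex) \<Rightarrow> complex"
  assumes vanish_outside: "\<lbrakk>f \<in> H; x \<notin> X\<rbrakk> \<Longrightarrow> f x = 0"
    and zero_mem: "(\<lambda>x. 0) \<in> H"
    and add_mem: "\<lbrakk>f \<in> H; g \<in> H\<rbrakk> \<Longrightarrow> (\<lambda>x. f x + g x) \<in> H"
    and scale_mem: "f \<in> H \<Longrightarrow> (\<lambda>x. c * f x) \<in> H"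
    and ip_add_left:
      "\<lbrakk>f \<in> H; g \<in> H; h \<in> H\<rbrakk> \<Longrightarrow> ip (\<lambda>x. f x + g x) h = ip f h + ip g h"
    and ip_scale_left: "\<lbrakk>f \<in> H; g \<in> H\<rbrakk> \<Longrightarrow> ip (\<lambda>x. c * f x) g = c * ip f g"
    and ip_commute: "\<lbrakk>f \<in> H; g \<in> H\<rbrakk> \<Longrightarrow> ip g f = cnj (ip f g)"
    and ip_self_nonneg: "f \<in> H \<Longrightarrow> 0 \<le> Re (ip f f)"
    and ip_self_eq_0: "\<lbrakk>f \<in> H; ip f f = 0\<rbrakk> \<Longrightarrow> f = (\<lambda>x. 0)"
    and complete:
      "\<lbrakk>\<And>n. F n \<in> H;
        \<And>e. e > 0 \<Longrightarrow> \<exists>M. \<forall>m\<ge>M. \<forall>n\<ge>M.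
           sqrt (Re (ip (\<lambda>x. F m x - F n x) (\<lambda>x. F m x - F n x))) < e\<rbrakk>
       \<Longrightarrow> \<exists>f\<in>H. (\<lambda>n::nat. sqrt (Re (ip (\<lambda>x. F n x - f x) (\<lambda>x. F n x - f x))))
                  \<longlonglongrightarrow> 0"

locale rkhs = function_hilbert_space X H ip
  for X :: "'a set" and K :: "'a \<Rightarrow> 'a \<Rightarrow> complex" and H and ip +
  assumes kernel_mem: "y \<in> X \<Longrightarrow> (\<lambda>x. if x \<in> X then K x y else 0) \<in> H"
    and reproducing:
      "\<lbrakk>f \<in> H; y \<in> X\<rbrakk> \<Longrightarrow> f y = ip f (\<lambda>x. if x \<in> X then K x y else 0)"

definition unit_cube :: "nat \<Rightarrow> (nat \<Rightarrow> real) set" where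
  "unit_cube d = {1..d} \<rightarrow>\<^sub>E {0..1}"

definition korobov_kernel ::
  "nat \<Rightarrow> real \<Rightarrow> (nat set \<Rightarrow> real) \<Rightarrow> (nat \<Rightarrow> real) \<Rightarrow> (nat \<Rightarrow> real) \<Rightarrow> complex" where
  "korobov_kernel d \<alpha> \<gamma> x y =
     1 + (\<Sum>u\<in>Pow {1..d} - {{}}. of_real (\<gamma> u) *
       (\<Sum>\<^sub>\<infinity>h\<in>u \<rightarrow>\<^sub>E (UNIV - {0 :: int}).
          exp (2 * of_real pi * \<i> * of_real (\<Sum>j\<in>u. of_int (h j) * (x j - y j)))
          / of_real (\<Prod>j\<in>u. \<bar>of_int (h j)\<bar> powr \<alpha>)))"

text \<open>By the Moore--Aronszajn theorem the reproducing kernel Hilbert space exists and is unique;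
  the choice below only affects the irrelevant values of the inner product
  outside the space.\<close>

definition korobov_space ::
  "nat \<Rightarrow> real \<Rightarrow> (nat set \<Rightarrow> real) \<Rightarrow>
     ((nat \<Rightarrow> real) \<Rightarrow> complex) set \<times>
     (((nat \<Rightarrow> real) \<Rightarrow> complex) \<Rightarrow> ((nat \<Rightarrow> real) \<Rightarrow> complex) \<Rightarrow> complex)" where
  "korobov_space d \<alpha> \<gamma> =
     (SOME (H, ip). rkhs (unit_cube d) (korobov_kernel d \<alpha> \<gamma>) H ip)"

definition korobov_unit_ball ::
  "nat \<Rightarrow> real \<Rightarrow> (nat set \<Rightarrow> real) \<Rightarrow> ((nat \<Rightarrow> real) \<Rightarrow> complex) set" where
  "korobov_unit_ball d \<alpha> \<gamma> =
     (case korobov_space d \<alpha> \<gamma> of (H, ip) \<Rightarrow> {f \<in> H. sqrt (Re (ip f f)) \<le> 1})"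

definition lattice_point :: "nat \<Rightarrow> nat \<Rightarrow> (nat \<Rightarrow> int) \<Rightarrow> nat \<Rightarrow> (nat \<Rightarrow> real)" where
  "lattice_point N d z k = (\<lambda>j\<in>{1..d}. frac (real k / real N * of_int (z j)))"

definition lattice_rule ::
  "nat \<Rightarrow> nat \<Rightarrow> (nat \<Rightarrow> int) \<Rightarrow> ((nat \<Rightarrow> real) \<Rightarrow> complex) \<Rightarrow> complex" where
  "lattice_rule N d z f = (\<Sum>k<N. f (lattice_point N d z k)) / of_nat N"

definition cube_integral :: "nat \<Rightarrow> ((nat \<Rightarrow> real) \<Rightarrow> complex) \<Rightarrow> complex" where
  "cube_integral d f =
     set_lebesgue_integral (PiM {1..d} (\<lambda>_. lborel)) (unit_cube d) f"

definition worst_case_error ::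
  "nat \<Rightarrow> nat \<Rightarrow> real \<Rightarrow> (nat set \<Rightarrow> real) \<Rightarrow> (nat \<Rightarrow> int) \<Rightarrow> real" where
  "worst_case_error N d \<alpha> \<gamma> z =
     (SUP f\<in>korobov_unit_ball d \<alpha> \<gamma>. cmod (cube_integral d f - lattice_rule N d z f))"

definition reduced_candidates :: "nat \<Rightarrow> nat \<Rightarrow> nat \<Rightarrow> int set" where
  "reduced_candidates b m wj =
     (if wj < m then {c \<in> {1..int b ^ (m - wj) - 1}. gcd c (int b ^ m) = 1} else {1})"

definition reduced_vector :: "nat \<Rightarrow> (nat \<Rightarrow> nat) \<Rightarrow> (nat \<Rightarrow> int) \<Rightarrow> (nat \<Rightarrow> int)" where
  "reduced_vector b w z = (\<lambda>j. int b ^ w j * z j)"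

text \<open>The minimizer in each step need not be unique, so the construction is a predicate that
  holds for every admissible sequence of choices.\<close>

definition reduced_cbc ::
  "nat \<Rightarrow> nat \<Rightarrow> nat \<Rightarrow> real \<Rightarrow> (nat set \<Rightarrow> real) \<Rightarrow> (nat \<Rightarrow> nat) \<Rightarrow> (nat \<Rightarrow> int) \<Rightarrow> bool" where
  "reduced_cbc b m s \<alpha> \<gamma> w z \<longleftrightarrow>
     z 1 = 1 \<and>
     (\<forall>d\<in>{1..<s}.
        is_arg_min
          (\<lambda>c. (worst_case_error (b ^ m) (d + 1) \<alpha> \<gamma>
                  (reduced_vector b w (z(d + 1 := c))))\<^sup>2)
          (\<lambda>c. c \<in> reduced_candidates b m (w (d + 1)))
          (z (d + 1)))"

definition zeta_real :: "real \<Rightarrow> real" where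
  "zeta_real x = (\<Sum>n. real (Suc n) powr (- x))"

end

theory Submission
  imports Defs "HOL-Number_Theory.Totient"
begin

text \<open>
  Every bounded functional \<open>L\<close> on a reproducing kernel Hilbert space has norm \<open>sqrt (L \<xi>)\<close> with
  \<open>\<xi> y = cnj (L (K \<cdot> y))\<close>. For the integration error this gives the worst-case error as
  \<open>e\<^sup>2 = (\<Sum>u. \<gamma> u * S u)\<close>, where \<open>S u\<close> sums \<open>\<Prod>j\<in>u. \<bar>h j\<bar> powr - \<alpha>\<close> over the dual lattice. As the
  Korobov space is a chosen object, a space with this kernel must first be exhibited: it is the
  space of absolutely convergent Fourier series with suitably weighted square-summable coefficients.

  The bound follows by induction on the dimension \<open>d\<close>. The minimal increment of \<open>e\<^sup>2\<close> is at most each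
  of the candidate increments, so its \<open>\<lambda>\<close>-th power is at most the average of their \<open>\<lambda>\<close>-th powers.
  By subadditivity of \<open>x powr \<lambda>\<close> this average is controlled by dual sums with exponent \<open>\<alpha> * \<lambda>\<close>, and
  for fixed other components \<open>A\<close> a unit \<open>c\<close> modulo \<open>M = b ^ (m - w)\<close> solves \<open>A + h * c \<equiv> 0\<close> with
  frequency at most \<open>2 * gcd A M / M\<close>, and only if \<open>gcd A M\<close> divides \<open>h\<close>.
\<close>

section \<open>Bounded functionals on reproducing kernel Hilbert spaces\<close>

text \<open>The Korobov space is picked by a choice operator, so nothing is known of it beyond the
  kernel axioms. This forces the detour through representers: the values of the representer are
  fixed by the functional and the kernel alone, so every space with this kernel yields the same
  error and uniqueness of the space need not be proved. Integration is not a finite combination of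
  point evaluations, hence a Riesz theorem for abstract function spaces.

  The factor 2 in front of the zeta power has one source: at least half of the residues modulo
  \<open>b ^ (m - w)\<close> are candidates, because \<open>2 * (b - 1) \<ge> b\<close>. If
  \<open>w \<ge> m\<close>, nothing is averaged; the denominator is 1 and dropping the congruence
  altogether is good enough.

  The induction runs on \<lambda>-th powers of the squared error, for which the contributions of
  successive components simply add up. Monotonicity of \<open>w\<close> makes all sets with largest
  element \<open>d + 1\<close> share the exponent \<open>m - w (d + 1)\<close>, so that the new
  contribution matches the new terms of the bound.\<close>

context function_hilbert_space
begin

lemma diff_mem: "\<lbrakk>f \<in> H; g \<in> H\<rbrakk> \<Longrightarrow> (\<lambda>x. f x - g x) \<in> H"
  using add_mem[of f "\<lambda>x. - 1 * g x"] scale_mem[of g "-1"] by simp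

lemma sum_mem: "finite A \<Longrightarrow> (\<And>i. i \<in> A \<Longrightarrow> f i \<in> H) \<Longrightarrow> (\<lambda>x. \<Sum>i\<in>A. f i x) \<in> H"
  by (induction A rule: finite_induct) (auto intro: zero_mem add_mem)

lemma ip_add_right:
  assumes "f \<in> H" "g \<in> H" "h \<in> H"
  shows "ip h (\<lambda>x. f x + g x) = ip h f + ip h g"
proof -
  have "ip h (\<lambda>x. f x + g x) = cnj (ip (\<lambda>x. f x + g x) h)"
    using assms by (intro ip_commute add_mem)
  also have "\<dots> = cnj (ip f h) + cnj (ip g h)"
    using assms by (simp add: ip_add_left)
  finally show ?thesis
    using assms by (simp add: ip_commute[of _ h])
qed

lemma ip_scale_right:
  assumes "f \<in> H" "h \<in> H"
  shows "ip h (\<lambda>x. c * f x) = cnj c * ip h f"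
proof -
  have "ip h (\<lambda>x. c * f x) = cnj (ip (\<lambda>x. c * f x) h)"
    using assms by (intro ip_commute scale_mem)
  also have "\<dots> = cnj c * cnj (ip f h)"
    using assms by (simp add: ip_scale_left)
  finally show ?thesis
    using assms by (simp add: ip_commute[of _ h])
qed

lemma ip_diff_right:
  assumes "f \<in> H" "g \<in> H" "h \<in> H"
  shows "ip h (\<lambda>x. f x - g x) = ip h f - ip h g"
  using ip_add_right[of f "\<lambda>x. - 1 * g x" h] ip_scale_right[of g h "-1"] assms scale_mem[of g "-1"]
  by simp

lemma ip_self_real: "f \<in> H \<Longrightarrow> ip f f = of_real (Re (ip f f))"
  using ip_commute[of f f] by (simp add: complex_eq_iff)

definition sqnorm :: "('a \<Rightarrow> complex) \<Rightarrow> real" where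
  "sqnorm f = Re (ip f f)"

lemma sqnorm_nonneg: "f \<in> H \<Longrightarrow> 0 \<le> sqnorm f"
  unfolding sqnorm_def by (rule ip_self_nonneg)

text \<open>This expansion drives all quadratic arguments below: Cauchy-Schwarz by a minimising
  \<open>c\<close>, the parallelogram law by \<open>c = 1\<close> and \<open>c = -1\<close>, and the
  first variation in the Riesz theorem by a real \<open>c\<close>.\<close>

lemma sqnorm_add_scale:
  assumes "f \<in> H" "g \<in> H"
  shows "sqnorm (\<lambda>x. f x + c * g x) = sqnorm f + 2 * Re (cnj c * ip f g) + (cmod c)\<^sup>2 * sqnorm g"
proof -
  have cg: "(\<lambda>x. c * g x) \<in> H" using assms by (intro scale_mem)
  have "ip (\<lambda>x. f x + c * g x) (\<lambda>x. f x + c * g x) =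
      ip f f + cnj c * ip f g + (c * cnj (ip f g) + c * (cnj c * ip g g))"
    using assms cg by (simp add: ip_add_left ip_add_right add_mem ip_scale_left ip_scale_right
        ip_commute[of f g] distrib_left)
  moreover have "c * (cnj c * ip g g) = of_real ((cmod c)\<^sup>2 * sqnorm g)"
    unfolding sqnorm_def of_real_mult ip_self_real[OF assms(2), symmetric]
    using complex_norm_square[of c] by simp
  moreover have "Re (c * cnj (ip f g)) = Re (cnj c * ip f g)" by simp
  ultimately show ?thesis unfolding sqnorm_def by simp
qed

lemma sqnorm_scale: "f \<in> H \<Longrightarrow> sqnorm (\<lambda>x. c * f x) = (cmod c)\<^sup>2 * sqnorm f"
proof -
  assume f: "f \<in> H"
  have "ip (\<lambda>x. c * f x) (\<lambda>x. c * f x) = c * (cnj c * ip f f)"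
    using f by (simp add: ip_scale_left ip_scale_right scale_mem)
  also have "\<dots> = of_real ((cmod c)\<^sup>2 * sqnorm f)"
    unfolding sqnorm_def of_real_mult ip_self_real[OF f, symmetric]
    using complex_norm_square[of c] by simp
  finally show ?thesis by (simp add: sqnorm_def)
qed

lemma sqnorm_diff:
  assumes "f \<in> H" "g \<in> H"
  shows "sqnorm (\<lambda>x. f x - g x) = sqnorm f - 2 * Re (ip f g) + sqnorm g"
  using sqnorm_add_scale[OF assms, of "-1"] by simp

lemma ip_zero_right: "f \<in> H \<Longrightarrow> ip f (\<lambda>x. 0) = 0"
  using ip_scale_right[of f f 0] by simp

lemma cauchy_schwarz:
  assumes "f \<in> H" "g \<in> H"
  shows "(cmod (ip f g))\<^sup>2 \<le> sqnorm f * sqnorm g"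
proof (cases "sqnorm g = 0")
  case True
  then have "g = (\<lambda>x. 0)"
    using ip_self_eq_0[of g] ip_self_real[of g] assms by (simp add: sqnorm_def)
  then have "ip f g = 0" using assms ip_zero_right by simp
  with True show ?thesis by simp
next
  case False
  then have pos: "sqnorm g > 0" using sqnorm_nonneg[OF assms(2)] by simp
  \<comment> \<open>This \<open>c\<close> minimises
    \<open>sqnorm (\<lambda>x. f x + c * g x)\<close>: it removes from \<open>f\<close> its
    projection onto \<open>g\<close>.\<close>
  define c where "c = - ip f g / of_real (sqnorm g)"
  have "0 \<le> sqnorm (\<lambda>x. f x + c * g x)"
    using assms by (intro sqnorm_nonneg add_mem scale_mem)
  also have "\<dots> = sqnorm f + 2 * Re (cnj c * ip f g) + (cmod c)\<^sup>2 * sqnorm g"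
    by (rule sqnorm_add_scale[OF assms])
  also have "cnj c * ip f g = - of_real ((cmod (ip f g))\<^sup>2 / sqnorm g)"
    unfolding c_def using complex_norm_square[of "ip f g"] by (simp add: mult.commute)
  also have "(cmod c)\<^sup>2 * sqnorm g = (cmod (ip f g))\<^sup>2 / sqnorm g"
    unfolding c_def using pos by (simp add: norm_divide power_divide power2_eq_square)
  finally have "(cmod (ip f g))\<^sup>2 / sqnorm g \<le> sqnorm f" by simp
  with pos show ?thesis by (simp add: field_simps)
qed

lemma cmod_ip_le:
  assumes "f \<in> H" "g \<in> H"
  shows "cmod (ip f g) \<le> sqrt (sqnorm f) * sqrt (sqnorm g)"
  using cauchy_schwarz[OF assms] by (metis norm_ge_zero real_le_rsqrt real_sqrt_mult)

lemma parallelogram_law: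
  assumes "f \<in> H" "g \<in> H"
  shows "sqnorm (\<lambda>x. f x + g x) + sqnorm (\<lambda>x. f x - g x) = 2 * sqnorm f + 2 * sqnorm g"
  using sqnorm_add_scale[OF assms, of 1] sqnorm_diff[OF assms] by simp

text \<open>Linearity and the bound are asked for on \<open>H\<close> only: the integral is additive
  on integrable functions, and integrability will be derived from membership in
  \<open>H\<close>.\<close>

definition bounded_functional :: "(('a \<Rightarrow> complex) \<Rightarrow> complex) \<Rightarrow> real \<Rightarrow> bool" where
  "bounded_functional L C \<longleftrightarrow>
     (\<forall>f\<in>H. \<forall>g\<in>H. L (\<lambda>x. f x + g x) = L f + L g) \<and>
     (\<forall>f\<in>H. \<forall>c. L (\<lambda>x. c * f x) = c * L f) \<and>
     (\<forall>f\<in>H. cmod (L f) \<le> C * sqrt (sqnorm f))"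

text \<open>The representer is the minimiser of \<open>\<parallel>f\<parallel>\<^sup>2 - 2 Re (L f)\<close>; a minimising sequence is
  Cauchy by the parallelogram law.\<close>

lemma riesz_representation:
  assumes "bounded_functional L C" "C \<ge> 0"
  obtains g where "g \<in> H" "\<And>f. f \<in> H \<Longrightarrow> L f = ip f g"
proof -
  have L_add: "L (\<lambda>x. f x + g x) = L f + L g" if "f \<in> H" "g \<in> H" for f g
    using assms(1) that by (simp add: bounded_functional_def)
  have L_scale: "L (\<lambda>x. c * f x) = c * L f" if "f \<in> H" for f c
    using assms(1) that by (simp add: bounded_functional_def)
  have L_le: "cmod (L f) \<le> C * sqrt (sqnorm f)" if "f \<in> H" for f
    using assms(1) that by (simp add: bounded_functional_def)
  define J where "J f = sqnorm f - 2 * Re (L f)" for f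
  have J_ge: "J f \<ge> - (C\<^sup>2)" if "f \<in> H" for f
  proof -
    have "Re (L f) \<le> C * sqrt (sqnorm f)"
      using L_le[OF that] complex_Re_le_cmod[of "L f"] by linarith
    moreover have "sqnorm f = (sqrt (sqnorm f))\<^sup>2" using sqnorm_nonneg[OF that] by simp
    ultimately have "J f \<ge> (sqrt (sqnorm f) - C)\<^sup>2 - C\<^sup>2"
      unfolding J_def by (simp add: power2_diff algebra_simps)
    then show ?thesis using zero_le_power2[of "sqrt (sqnorm f) - C"] by linarith
  qed
  define \<mu> where "\<mu> = (INF f\<in>H. J f)"
  have bdd: "bdd_below (J ` H)" using J_ge by (auto simp: bdd_below_def)
  have mu_le: "\<mu> \<le> J f" if "f \<in> H" for f
    unfolding \<mu>_def using bdd that by (rule cINF_lower)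
  have "\<exists>f\<in>H. J f < \<mu> + inverse (real (Suc n))" for n
    using cINF_less_iff[of H J "\<mu> + inverse (real (Suc n))"] bdd zero_mem
    unfolding \<mu>_def[symmetric] by auto
  then obtain F where F: "\<And>n. F n \<in> H" "\<And>n. J (F n) < \<mu> + inverse (real (Suc n))"
    by metis
  \<comment> \<open>Four times \<open>J\<close> at the midpoint is \<open>2 * J f + 2 * J g\<close>
    minus the squared distance, and \<open>J\<close> at the midpoint is at least \<mu>.\<close>
  have close: "sqnorm (\<lambda>x. f x - g x) \<le> 2 * (J f - \<mu>) + 2 * (J g - \<mu>)" if "f \<in> H" "g \<in> H" for f g
  proof -
    let ?h = "\<lambda>x. (1/2) * (f x + g x)"
    have "\<mu> \<le> J ?h" using that by (intro mu_le scale_mem add_mem)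
    also have "J ?h = sqnorm (\<lambda>x. f x + g x) / 4 - Re (L f + L g)"
    proof -
      have "sqnorm ?h = (cmod (1/2))\<^sup>2 * sqnorm (\<lambda>x. f x + g x)"
        using that by (intro sqnorm_scale add_mem)
      moreover have "L ?h = 1/2 * (L f + L g)"
        using L_scale[of "\<lambda>x. f x + g x" "1/2"] that by (simp only: add_mem L_add)
      ultimately show ?thesis
        unfolding J_def by (simp only:) (simp add: power2_eq_square field_simps)
    qed
    finally show ?thesis using parallelogram_law[OF that] unfolding J_def by simp
  qed
  have "\<exists>M. \<forall>m\<ge>M. \<forall>n\<ge>M. sqrt (Re (ip (\<lambda>x. F m x - F n x) (\<lambda>x. F m x - F n x))) < e"
    if "e > 0" for e
  proof -
    have "(\<lambda>n. inverse (real (Suc n))) \<longlonglongrightarrow> 0" by (rule LIMSEQ_inverse_real_of_nat)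
    then have "eventually (\<lambda>n. inverse (real (Suc n)) < e\<^sup>2 / 4) sequentially"
      using that by (intro order_tendstoD) auto
    then obtain M where M: "\<And>n. n \<ge> M \<Longrightarrow> inverse (real (Suc n)) < e\<^sup>2 / 4"
      by (auto simp: eventually_sequentially)
    have "sqnorm (\<lambda>x. F m x - F n x) < e\<^sup>2" if "m \<ge> M" "n \<ge> M" for m n
      using close[OF F(1)[of m] F(1)[of n]] less_trans[OF F(2)[of m] add_strict_left_mono[OF M[OF that(1)]]]
        less_trans[OF F(2)[of n] add_strict_left_mono[OF M[OF that(2)]]] by argo
    then have "sqrt (Re (ip (\<lambda>x. F m x - F n x) (\<lambda>x. F m x - F n x))) < e" if "m \<ge> M" "n \<ge> M" for m n
      using that \<open>e > 0\<close> real_sqrt_less_mono[of _ "e\<^sup>2"] unfolding sqnorm_def by fastforce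
    then show ?thesis by blast
  qed
  from complete[OF F(1) this] obtain g where g: "g \<in> H"
    "(\<lambda>n. sqrt (Re (ip (\<lambda>x. F n x - g x) (\<lambda>x. F n x - g x)))) \<longlonglongrightarrow> 0" by blast
  define \<delta> where "\<delta> n = sqrt (sqnorm (\<lambda>x. F n x - g x))" for n
  have \<delta>: "\<delta> \<longlonglongrightarrow> 0" using g(2) by (simp add: \<delta>_def[abs_def] sqnorm_def)
  \<comment> \<open>Expansion of \<open>J (F n)\<close> around \<open>g\<close>, with Cauchy-Schwarz
    and the bound on \<open>L\<close>; as \<delta> tends to 0, \<open>g\<close> becomes a
    minimiser.\<close>
  have "J g \<le> J (F n) + 2 * \<delta> n * (sqrt (sqnorm g) + C)" for n
  proof -
    let ?d = "\<lambda>x. F n x - g x"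
    have d: "?d \<in> H" using F(1) g(1) by (rule diff_mem)
    have "sqnorm (F n) = sqnorm g + 2 * Re (ip g ?d) + sqnorm ?d"
      using sqnorm_add_scale[OF g(1) d, of 1] by simp
    moreover have "L (F n) = L g + L ?d"
      using L_add[OF g(1) d] by simp
    moreover have "\<bar>Re (ip g ?d)\<bar> \<le> sqrt (sqnorm g) * \<delta> n"
      using cmod_ip_le[OF g(1) d] abs_Re_le_cmod[of "ip g ?d"] unfolding \<delta>_def by linarith
    moreover have "\<bar>Re (L ?d)\<bar> \<le> C * \<delta> n"
      using L_le[OF d] abs_Re_le_cmod[of "L ?d"] unfolding \<delta>_def by linarith
    ultimately show ?thesis using sqnorm_nonneg[OF d]
      unfolding J_def by (simp add: algebra_simps)
  qed
  then have "J g \<le> \<mu> + inverse (real (Suc n)) + 2 * \<delta> n * (sqrt (sqnorm g) + C)" for n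
    using F(2)[of n] by (meson add_right_mono less_imp_le order_trans)
  moreover have "(\<lambda>n. \<mu> + inverse (real (Suc n)) + 2 * \<delta> n * (sqrt (sqnorm g) + C))
      \<longlonglongrightarrow> \<mu> + 0 + 2 * 0 * (sqrt (sqnorm g) + C)"
    by (intro tendsto_intros LIMSEQ_inverse_real_of_nat \<delta>)
  ultimately have J_min: "J g \<le> J f" if "f \<in> H" for f
    using mu_le[OF that] LIMSEQ_le_const[of _ "\<mu> + 0 + 2 * 0 * (sqrt (sqnorm g) + C)" "J g"]
    by fastforce
  have Re0: "Re (ip f g - L f) = 0" if f: "f \<in> H" for f
  proof (rule ccontr)
    define D where "D = Re (ip f g - L f)"
    assume "Re (ip f g - L f) \<noteq> 0"
    then have D: "D \<noteq> 0" by (simp add: D_def)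
    \<comment> \<open>The minimiser of \<open>2 * t * D + t\<^sup>2 * (sqnorm f + 1)\<close>; the
      added 1 keeps the denominator positive even for \<open>f\<close> of norm 0.\<close>
    define t where "t = - D / (sqnorm f + 1)"
    have p: "sqnorm f + 1 > 0" using sqnorm_nonneg[OF f] by simp
    have "J g \<le> J (\<lambda>x. g x + of_real t * f x)"
      using f g(1) by (intro J_min add_mem scale_mem)
    also have "\<dots> = J g + 2 * t * D + t\<^sup>2 * sqnorm f"
      unfolding J_def D_def using f g(1)
      by (simp add: sqnorm_add_scale L_add L_scale scale_mem ip_commute[of f g] algebra_simps)
    finally have "0 \<le> 2 * t * D + t\<^sup>2 * sqnorm f" by simp
    also have "\<dots> \<le> 2 * t * D + t\<^sup>2 * (sqnorm f + 1)" by (simp add: algebra_simps)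
    also have "t\<^sup>2 * (sqnorm f + 1) = t * - D"
      unfolding t_def power2_eq_square using p by simp
    also have "2 * t * D + t * - D = - (D\<^sup>2 / (sqnorm f + 1))"
      by (simp add: t_def power2_eq_square)
    also have "\<dots> < 0" using D p by simp
    finally show False by simp
  qed
  have "L f = ip f g" if f: "f \<in> H" for f
  proof -
    have "Re (ip f g - L f) = 0" by (rule Re0[OF f])
    \<comment> \<open>Real parts suffice: passing from \<open>f\<close> to \<open>\<i> * f\<close>
      turns the imaginary part into a real part, up to sign.\<close>
    moreover have "Im (ip f g - L f) = 0"
      using Re0[OF scale_mem[OF f, of \<i>]] f g(1) by (simp add: ip_scale_left L_scale)
    ultimately show ?thesis by (simp add: complex_eq_iff)
  qed
  with g(1) show ?thesis by (rule that)
qed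

text \<open>The supremum is a maximum, attained at \<open>g\<close> divided by its norm, or at
  \<open>g\<close> itself if that norm is 0; Cauchy-Schwarz is the upper bound.\<close>

lemma SUP_unit_ball_ip:
  assumes g: "g \<in> H"
  shows "(SUP f\<in>{f \<in> H. sqrt (Re (ip f f)) \<le> 1}. cmod (ip f g)) = sqrt (sqnorm g)"
proof (rule cSup_eq_maximum)
  show "sqrt (sqnorm g) \<in> (\<lambda>f. cmod (ip f g)) ` {f \<in> H. sqrt (Re (ip f f)) \<le> 1}"
  proof (cases "sqnorm g = 0")
    case True
    then have "ip g g = 0" using ip_self_real[OF g] by (simp add: sqnorm_def)
    with True g show ?thesis by (intro image_eqI[of _ _ g]) auto
  next
    case False
    then have pos: "sqnorm g > 0" using sqnorm_nonneg[OF g] by simp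
    define c where "c = complex_of_real (1 / sqrt (sqnorm g))"
    have cc: "cmod c = 1 / sqrt (sqnorm g)" unfolding c_def norm_of_real using pos by simp
    have "ip g g = of_real (sqnorm g)" using ip_self_real[OF g] by (simp add: sqnorm_def)
    then have "cmod (ip (\<lambda>x. c * g x) g) = sqrt (sqnorm g)"
      using pos by (simp add: ip_scale_left g norm_mult cc real_div_sqrt)
    moreover have "sqnorm (\<lambda>x. c * g x) = 1"
      using pos by (simp add: sqnorm_scale g cc power_divide)
    ultimately show ?thesis using g scale_mem[OF g, of c]
      by (intro image_eqI[of _ _ "\<lambda>x. c * g x"]) (auto simp: sqnorm_def)
  qed
next
  fix y assume "y \<in> (\<lambda>f. cmod (ip f g)) ` {f \<in> H. sqrt (Re (ip f f)) \<le> 1}"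
  then obtain f where f: "f \<in> H" "sqrt (sqnorm f) \<le> 1" "y = cmod (ip f g)"
    by (auto simp: sqnorm_def)
  have "y \<le> sqrt (sqnorm f) * sqrt (sqnorm g)" using f g cmod_ip_le by simp
  also have "\<dots> \<le> 1 * sqrt (sqnorm g)"
    using f(2) sqnorm_nonneg[OF g] by (intro mult_right_mono) auto
  finally show "y \<le> sqrt (sqnorm g)" by simp
qed

end

section \<open>Point evaluations and representers in a reproducing kernel space\<close>

context rkhs
begin

definition kern :: "'a \<Rightarrow> 'a \<Rightarrow> complex" where
  "kern y = (\<lambda>x. if x \<in> X then K x y else 0)"

lemma kern_mem: "y \<in> X \<Longrightarrow> kern y \<in> H"
  unfolding kern_def by (rule kernel_mem)

lemma eval_eq_ip: "f \<in> H \<Longrightarrow> y \<in> X \<Longrightarrow> f y = ip f (kern y)"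
  unfolding kern_def by (rule reproducing)

lemma ip_kern: "x \<in> X \<Longrightarrow> y \<in> X \<Longrightarrow> ip (kern y) (kern x) = K x y"
  using eval_eq_ip[OF kern_mem, of y x] by (simp add: kern_def)

lemma sqnorm_kern: "x \<in> X \<Longrightarrow> sqnorm (kern x) = Re (K x x)"
  by (simp add: sqnorm_def ip_kern)

lemma cmod_eval_le:
  assumes "f \<in> H" "x \<in> X"
  shows "cmod (f x) \<le> sqrt (sqnorm f) * sqrt (Re (K x x))"
  using cmod_ip_le[OF assms(1) kern_mem[OF assms(2)]] assms by (simp add: eval_eq_ip[symmetric] sqnorm_kern)

text \<open>Transfers continuity of the kernel to every element of the space, which is what makes
  these elements integrable over the cube.\<close>

lemma cmod_eval_diff_le:
  assumes "f \<in> H" "x \<in> X" "y \<in> X"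
  shows "cmod (f x - f y) \<le> sqrt (sqnorm f) * sqrt (Re (K x x) - 2 * Re (K y x) + Re (K y y))"
proof -
  have "f x - f y = ip f (\<lambda>t. kern x t - kern y t)"
    using assms by (simp add: ip_diff_right kern_mem eval_eq_ip)
  then have "cmod (f x - f y) \<le> sqrt (sqnorm f) * sqrt (sqnorm (\<lambda>t. kern x t - kern y t))"
    using cmod_ip_le[OF assms(1) diff_mem[OF kern_mem kern_mem, of x y]] assms by simp
  also have "sqnorm (\<lambda>t. kern x t - kern y t) = Re (K x x) - 2 * Re (K y x) + Re (K y y)"
    using assms by (simp add: sqnorm_diff kern_mem sqnorm_kern ip_kern)
  finally show ?thesis .
qed

text \<open>The Riesz representer \<open>g\<close> has the values
  \<open>g x = ip g (kern x) = cnj (L (kern x))\<close>, so it can be written down from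
  \<open>L\<close> and the kernel, and its squared norm is \<open>L g\<close>.\<close>

lemma SUP_unit_ball_functional:
  assumes "bounded_functional L C" "C \<ge> 0"
  defines "\<xi> \<equiv> \<lambda>x. if x \<in> X then cnj (L (kern x)) else 0"
  shows "\<xi> \<in> H" and "(SUP f\<in>{f \<in> H. sqrt (Re (ip f f)) \<le> 1}. cmod (L f)) = sqrt (Re (L \<xi>))"
proof -
  obtain g where g: "g \<in> H" "\<And>f. f \<in> H \<Longrightarrow> L f = ip f g"
    using riesz_representation[OF assms(1,2)] by blast
  have "g = \<xi>"
  proof
    fix x show "g x = \<xi> x"
    proof (cases "x \<in> X")
      case True
      then show ?thesis using g ip_commute[of "kern x" g]
        by (simp add: \<xi>_def kern_mem eval_eq_ip)
    qed (use vanish_outside[OF g(1)] in \<open>simp add: \<xi>_def\<close>)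
  qed
  with g(1) show "\<xi> \<in> H" by simp
  have "(SUP f\<in>{f \<in> H. sqrt (Re (ip f f)) \<le> 1}. cmod (L f)) =
      (SUP f\<in>{f \<in> H. sqrt (Re (ip f f)) \<le> 1}. cmod (ip f g))"
    using g(2) by (intro SUP_cong) auto
  also have "\<dots> = sqrt (sqnorm g)" by (rule SUP_unit_ball_ip[OF g(1)])
  also have "sqnorm g = Re (L \<xi>)" using g \<open>g = \<xi>\<close> by (simp add: sqnorm_def)
  finally show "(SUP f\<in>{f \<in> H. sqrt (Re (ip f f)) \<le> 1}. cmod (L f)) = sqrt (Re (L \<xi>))" .
qed

end

section \<open>Existence of the space from a feature map\<close>

text \<open>Vanishing outside \<open>I\<close> makes equal coefficients on \<open>I\<close> mean
  equal functions, so that the synthesis map can be injective.\<close>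

definition ell2 :: "'i set \<Rightarrow> ('i \<Rightarrow> complex) set" where
  "ell2 I = {c. (\<forall>i. i \<notin> I \<longrightarrow> c i = 0) \<and> (\<lambda>i. (cmod (c i))\<^sup>2) summable_on I}"

lemma ell2_outside: "c \<in> ell2 I \<Longrightarrow> i \<notin> I \<Longrightarrow> c i = 0"
  by (simp add: ell2_def)

lemma ell2_summable: "c \<in> ell2 I \<Longrightarrow> (\<lambda>i. (cmod (c i))\<^sup>2) summable_on I"
  by (simp add: ell2_def)

lemma cauchy_schwarz_summable:
  assumes "(\<lambda>i. (cmod (c i))\<^sup>2) summable_on I" "(\<lambda>i. (cmod (d i))\<^sup>2) summable_on I"
  shows "(\<lambda>i. cmod (c i * d i)) summable_on I"
  by (rule abs_summable_product) (use assms in \<open>simp_all add: norm_mult power2_eq_square\<close>)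

lemma ell2_zero: "(\<lambda>i. 0) \<in> ell2 I"
  by (simp add: ell2_def)

lemma ell2_scale: "c \<in> ell2 I \<Longrightarrow> (\<lambda>i. a * c i) \<in> ell2 I"
  by (auto simp: ell2_def norm_mult power_mult_distrib intro: summable_on_cmult_right)

lemma ell2_add:
  assumes "c \<in> ell2 I" "d \<in> ell2 I"
  shows "(\<lambda>i. c i + d i) \<in> ell2 I"
proof -
  have "(\<lambda>i. 2 * (cmod (c i))\<^sup>2 + 2 * (cmod (d i))\<^sup>2) summable_on I"
    using assms by (intro summable_on_add summable_on_cmult_right ell2_summable)
  moreover have "(cmod (c i + d i))\<^sup>2 \<le> 2 * (cmod (c i))\<^sup>2 + 2 * (cmod (d i))\<^sup>2" for i
  proof -
    have "(cmod (c i + d i))\<^sup>2 \<le> (cmod (c i) + cmod (d i))\<^sup>2"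
      by (intro power_mono norm_triangle_ineq) simp
    also have "\<dots> \<le> 2 * (cmod (c i))\<^sup>2 + 2 * (cmod (d i))\<^sup>2"
      using zero_le_power2[of "cmod (c i) - cmod (d i)"] by (simp add: power2_sum power2_diff)
    finally show ?thesis .
  qed
  ultimately have "(\<lambda>i. (cmod (c i + d i))\<^sup>2) summable_on I"
    by (rule summable_on_comparison_test) auto
  with assms show ?thesis by (simp add: ell2_def)
qed

lemma ell2_diff:
  assumes "c \<in> ell2 I" "d \<in> ell2 I"
  shows "(\<lambda>i. c i - d i) \<in> ell2 I"
  using ell2_add[OF assms(1) ell2_scale[OF assms(2), of "-1"]] by simp

text \<open>The limit is taken coordinatewise. The Cauchy bound survives because it holds for each
  finite partial sum, where passing to the limit is elementary, and finite sums control the infinite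
  one.\<close>

lemma ell2_complete:
  assumes c: "\<And>n. c n \<in> ell2 I"
    and Cauchy_c: "\<And>e. e > 0 \<Longrightarrow> \<exists>M. \<forall>m\<ge>M. \<forall>n\<ge>M. sqrt (\<Sum>\<^sub>\<infinity>i\<in>I. (cmod (c m i - c n i))\<^sup>2) < e"
  shows "\<exists>d\<in>ell2 I. (\<lambda>n::nat. sqrt (\<Sum>\<^sub>\<infinity>i\<in>I. (cmod (c n i - d i))\<^sup>2)) \<longlonglongrightarrow> 0"
proof -
  have diff: "(\<lambda>i. (cmod (c m i - c n i))\<^sup>2) summable_on I" for m n
    using ell2_summable[OF ell2_diff[OF c c]] .
  have finite_le: "(\<Sum>i\<in>F. (cmod (c m i - c n i))\<^sup>2) \<le> (\<Sum>\<^sub>\<infinity>i\<in>I. (cmod (c m i - c n i))\<^sup>2)"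
    if "finite F" "F \<subseteq> I" for F m n
    using that diff by (intro finite_sum_le_infsum) auto
  have "\<exists>l. (\<lambda>n. c n i) \<longlonglongrightarrow> l" for i
  proof (cases "i \<in> I")
    case True
    have "Cauchy (\<lambda>n. c n i)"
    proof (rule metric_CauchyI)
      fix e :: real assume "e > 0"
      then obtain M where M: "\<And>m n. m \<ge> M \<Longrightarrow> n \<ge> M \<Longrightarrow>
          sqrt (\<Sum>\<^sub>\<infinity>i\<in>I. (cmod (c m i - c n i))\<^sup>2) < e"
        using Cauchy_c by blast
      have "dist (c m i) (c n i) < e" if "m \<ge> M" "n \<ge> M" for m n
      proof -
        have "cmod (c m i - c n i) \<le> sqrt (\<Sum>\<^sub>\<infinity>i\<in>I. (cmod (c m i - c n i))\<^sup>2)"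
          using finite_le[of "{i}" m n] True by (intro real_le_rsqrt) auto
        then show ?thesis using M[OF that] by (simp add: dist_norm)
      qed
      then show "\<exists>M. \<forall>m\<ge>M. \<forall>n\<ge>M. dist (c m i) (c n i) < e" by blast
    qed
    then show ?thesis by (simp add: Cauchy_convergent_iff convergent_def)
  next
    case False
    then have "c n i = 0" for n using ell2_outside[OF c] by simp
    then show ?thesis by auto
  qed
  then obtain d where d: "\<And>i. (\<lambda>n. c n i) \<longlonglongrightarrow> d i" by metis
  have bound: "(\<lambda>i. (cmod (c m i - d i))\<^sup>2) summable_on I \<and>
      (\<Sum>\<^sub>\<infinity>i\<in>I. (cmod (c m i - d i))\<^sup>2) \<le> e\<^sup>2"
    if M: "\<And>m n. m \<ge> M \<Longrightarrow> n \<ge> M \<Longrightarrow> sqrt (\<Sum>\<^sub>\<infinity>i\<in>I. (cmod (c m i - c n i))\<^sup>2) < e" and m: "m \<ge> M"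
    for m M e
  proof -
    have le: "(\<Sum>i\<in>F. (cmod (c m i - d i))\<^sup>2) \<le> e\<^sup>2" if F: "finite F" "F \<subseteq> I" for F
    proof (rule LIMSEQ_le_const2)
      show "(\<lambda>n. \<Sum>i\<in>F. (cmod (c m i - c n i))\<^sup>2) \<longlonglongrightarrow> (\<Sum>i\<in>F. (cmod (c m i - d i))\<^sup>2)"
        by (intro tendsto_intros d)
      have "(\<Sum>i\<in>F. (cmod (c m i - c n i))\<^sup>2) \<le> e\<^sup>2" if "n \<ge> M" for n
        using finite_le[OF F, of m n] sqrt_le_D[OF less_imp_le[OF M[OF m that]]] by linarith
      then show "\<exists>M. \<forall>n\<ge>M. (\<Sum>i\<in>F. (cmod (c m i - c n i))\<^sup>2) \<le> e\<^sup>2" by blast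
    qed
    have "(\<lambda>i. (cmod (c m i - d i))\<^sup>2) summable_on I"
      using le by (intro nonneg_bdd_above_summable_on) (auto intro!: bdd_aboveI2)
    moreover from this have "(\<Sum>\<^sub>\<infinity>i\<in>I. (cmod (c m i - d i))\<^sup>2) \<le> e\<^sup>2"
      using le by (rule infsum_le_finite_sums)
    ultimately show ?thesis ..
  qed
  have "d \<in> ell2 I"
  proof -
    obtain M where M: "\<And>m n. m \<ge> M \<Longrightarrow> n \<ge> M \<Longrightarrow>
        sqrt (\<Sum>\<^sub>\<infinity>i\<in>I. (cmod (c m i - c n i))\<^sup>2) < 1"
      using Cauchy_c[of 1] by auto
    have "d i = 0" if "i \<notin> I" for i
      using d[of i] ell2_outside[OF c that] by (simp add: LIMSEQ_const_iff)
    \<comment> \<open>Only the difference to \<open>c M\<close> has been bounded, so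
      \<open>d\<close> is recovered as \<open>c M - (c M - d)\<close>.\<close>
    then have "(\<lambda>i. c M i - d i) \<in> ell2 I"
      using bound[of M 1 M] M ell2_outside[OF c] by (auto simp: ell2_def)
    from ell2_diff[OF c this, of M] show ?thesis by simp
  qed
  moreover have "(\<lambda>n. sqrt (\<Sum>\<^sub>\<infinity>i\<in>I. (cmod (c n i - d i))\<^sup>2)) \<longlonglongrightarrow> 0"
  proof (rule metric_LIMSEQ_I)
    fix e :: real assume "e > 0"
    then obtain M where M: "\<And>m n. m \<ge> M \<Longrightarrow> n \<ge> M \<Longrightarrow>
        sqrt (\<Sum>\<^sub>\<infinity>i\<in>I. (cmod (c m i - c n i))\<^sup>2) < e / 2"
      using Cauchy_c[of "e/2"] by auto
    have "dist (sqrt (\<Sum>\<^sub>\<infinity>i\<in>I. (cmod (c n i - d i))\<^sup>2)) 0 < e" if "n \<ge> M" for n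
    proof -
      have "sqrt (\<Sum>\<^sub>\<infinity>i\<in>I. (cmod (c n i - d i))\<^sup>2) \<le> e / 2"
        using bound[OF M that] \<open>e > 0\<close> by (intro real_le_lsqrt) auto
      moreover have "0 \<le> (\<Sum>\<^sub>\<infinity>i\<in>I. (cmod (c n i - d i))\<^sup>2)" by (intro infsum_nonneg) auto
      ultimately show ?thesis using \<open>e > 0\<close> by (simp add: dist_real_def)
    qed
    then show "\<exists>M. \<forall>n\<ge>M. dist (sqrt (\<Sum>\<^sub>\<infinity>i\<in>I. (cmod (c n i - d i))\<^sup>2)) 0 < e" by blast
  qed
  ultimately show ?thesis by blast
qed

definition ell2_ip :: "'i set \<Rightarrow> ('i \<Rightarrow> complex) \<Rightarrow> ('i \<Rightarrow> complex) \<Rightarrow> complex" where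
  "ell2_ip I c d = (\<Sum>\<^sub>\<infinity>i\<in>I. c i * cnj (d i))"

lemma ell2_ip_summable: "c \<in> ell2 I \<Longrightarrow> d \<in> ell2 I \<Longrightarrow> (\<lambda>i. c i * cnj (d i)) summable_on I"
  by (rule abs_summable_summable[OF cauchy_schwarz_summable]) (auto simp: ell2_def)

lemma infsum_complex_of_real: "(\<Sum>\<^sub>\<infinity>i\<in>I. complex_of_real (f i)) = of_real (\<Sum>\<^sub>\<infinity>i\<in>I. f i)"
proof (cases "f summable_on I")
  case True
  then show ?thesis by (intro infsumI has_sum_of_real has_sum_infsum)
next
  \<comment> \<open>As \<open>f\<close> is the real part of its complex image, neither family is
    summable and both sums take the default value 0.\<close>
  case False
  then have "\<not> (\<lambda>i. complex_of_real (f i)) summable_on I"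
    using summable_on_Re by fastforce
  with False show ?thesis by (simp add: infsum_not_exists)
qed

lemma ell2_ip_self: "ell2_ip I c c = of_real (\<Sum>\<^sub>\<infinity>i\<in>I. (cmod (c i))\<^sup>2)"
  unfolding ell2_ip_def infsum_complex_of_real[symmetric]
  by (intro infsum_cong) (simp add: complex_norm_square[symmetric])

text \<open>Injectivity of the synthesis map on \<open>\<ell>\<^sup>2\<close> allows transporting the inner product of \<open>\<ell>\<^sup>2\<close>
  without passing to a quotient.\<close>

theorem rkhs_of_feature_map:
  fixes \<phi> :: "'i \<Rightarrow> 'a \<Rightarrow> complex"
  assumes sq: "\<And>x. x \<in> X \<Longrightarrow> (\<lambda>i. (cmod (\<phi> i x))\<^sup>2) summable_on I"
    and K: "\<And>x y. x \<in> X \<Longrightarrow> y \<in> X \<Longrightarrow> K x y = (\<Sum>\<^sub>\<infinity>i\<in>I. \<phi> i x * cnj (\<phi> i y))"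
    and inj: "\<And>c. c \<in> ell2 I \<Longrightarrow> (\<And>x. x \<in> X \<Longrightarrow> (\<Sum>\<^sub>\<infinity>i\<in>I. c i * \<phi> i x) = 0) \<Longrightarrow> c = (\<lambda>_. 0)"
  shows "\<exists>H ip. rkhs X K H ip"
proof -
  define synth where "synth c = (\<lambda>x. if x \<in> X then \<Sum>\<^sub>\<infinity>i\<in>I. c i * \<phi> i x else 0)" for c
  have summ: "(\<lambda>i. c i * \<phi> i x) summable_on I" if "c \<in> ell2 I" "x \<in> X" for c x
    by (rule abs_summable_summable[OF cauchy_schwarz_summable])
      (use that sq in \<open>auto simp: ell2_def\<close>)
  have synth_add: "synth (\<lambda>i. c i + d i) = (\<lambda>x. synth c x + synth d x)"
    if "c \<in> ell2 I" "d \<in> ell2 I" for c d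
    using that by (auto simp: synth_def fun_eq_iff distrib_right infsum_add summ)
  have synth_scale: "synth (\<lambda>i. a * c i) = (\<lambda>x. a * synth c x)" for a c
    by (auto simp: synth_def fun_eq_iff mult.assoc infsum_cmult_right')
  have synth_diff: "synth (\<lambda>i. c i - d i) = (\<lambda>x. synth c x - synth d x)"
    if "c \<in> ell2 I" "d \<in> ell2 I" for c d
    using synth_add[OF that(1) ell2_scale[OF that(2), of "-1"]] synth_scale[of "-1" d] by simp
  have inj_synth: "inj_on synth (ell2 I)"
  proof (rule inj_onI)
    fix c d assume cd: "c \<in> ell2 I" "d \<in> ell2 I" "synth c = synth d"
    have "synth (\<lambda>i. c i - d i) x = 0" for x using cd by (simp add: synth_diff)
    then have "(\<Sum>\<^sub>\<infinity>i\<in>I. (c i - d i) * \<phi> i x) = 0" if "x \<in> X" for x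
      using that unfolding synth_def by meson
    with cd have "(\<lambda>i. c i - d i) = (\<lambda>_. 0)" by (intro inj ell2_diff)
    then show "c = d" by (simp add: fun_eq_iff)
  qed
  define H where "H = synth ` ell2 I"
  define coef where "coef = inv_into (ell2 I) synth"
  have coef_synth [simp]: "coef (synth c) = c" if "c \<in> ell2 I" for c
    unfolding coef_def using inj_synth that by (rule inv_into_f_f)
  have coef_mem: "coef f \<in> ell2 I" if "f \<in> H" for f
    using that unfolding H_def by auto
  have synth_coef: "synth (coef f) = f" if "f \<in> H" for f
    using that unfolding H_def by auto
  have synth_mem: "synth c \<in> H" if "c \<in> ell2 I" for c
    using that unfolding H_def by auto
  have coef_add: "coef (\<lambda>x. f x + g x) = (\<lambda>i. coef f i + coef g i)" if "f \<in> H" "g \<in> H" for f g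
  proof -
    have "(\<lambda>x. f x + g x) = synth (\<lambda>i. coef f i + coef g i)"
      using that by (simp add: synth_add coef_mem synth_coef)
    then show ?thesis using that by (simp add: ell2_add coef_mem)
  qed
  have coef_scale: "coef (\<lambda>x. a * f x) = (\<lambda>i. a * coef f i)" if "f \<in> H" for f a
  proof -
    have "(\<lambda>x. a * f x) = synth (\<lambda>i. a * coef f i)"
      using that by (simp add: synth_scale synth_coef)
    then show ?thesis using that by (simp add: ell2_scale coef_mem)
  qed
  have coef_diff: "coef (\<lambda>x. f x - g x) = (\<lambda>i. coef f i - coef g i)" if "f \<in> H" "g \<in> H" for f g
  proof -
    have "(\<lambda>x. f x - g x) = synth (\<lambda>i. coef f i - coef g i)"
      using that by (simp add: synth_diff coef_mem synth_coef)
    then show ?thesis using that by (simp add: ell2_diff coef_mem)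
  qed
  have zero: "(\<lambda>x. 0) = synth (\<lambda>i. 0)" by (simp add: synth_def fun_eq_iff)
  define ip where "ip f g = ell2_ip I (coef f) (coef g)" for f g
  have ip_self: "Re (ip f f) = (\<Sum>\<^sub>\<infinity>i\<in>I. (cmod (coef f i))\<^sup>2)" for f
    by (simp add: ip_def ell2_ip_self)
  \<comment> \<open>With these coefficients the inner product of \<open>f\<close> with the kernel
    section is the series of \<open>coef f i * \<phi> i y\<close>, which is \<open>f y\<close>: the
    reproducing property.\<close>
  have kernel: "(\<lambda>x. if x \<in> X then K x y else 0) = synth (\<lambda>i. if i \<in> I then cnj (\<phi> i y) else 0)"
    if "y \<in> X" for y
    using that by (auto simp: synth_def K fun_eq_iff mult.commute intro!: infsum_cong)
  have kernel_coef: "(\<lambda>i. if i \<in> I then cnj (\<phi> i y) else 0) \<in> ell2 I" if "y \<in> X" for y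
    using sq[OF that] by (auto simp: ell2_def cong: summable_on_cong)
  have "rkhs X K H ip"
  proof
    fix f x assume "f \<in> H" "x \<notin> X"
    then show "f x = 0" by (auto simp: H_def synth_def)
  next
    show "(\<lambda>x. 0) \<in> H" unfolding zero by (intro synth_mem ell2_zero)
  next
    fix f g assume fg: "f \<in> H" "g \<in> H"
    then show "(\<lambda>x. f x + g x) \<in> H"
      using synth_mem[OF ell2_add[OF coef_mem coef_mem], of f g]
      by (simp add: synth_add coef_mem synth_coef)
    show "ip g f = cnj (ip f g)"
      unfolding ip_def ell2_ip_def infsum_cnj[symmetric] by (simp add: mult.commute)
    show "ip (\<lambda>x. c * f x) g = c * ip f g" for c
      using fg by (simp add: ip_def ell2_ip_def coef_scale mult.assoc infsum_cmult_right')
    show "ip (\<lambda>x. f x + g x) h = ip f h + ip g h" if "h \<in> H" for h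
      using fg that by (simp add: ip_def ell2_ip_def coef_add distrib_right infsum_add
          ell2_ip_summable coef_mem)
  next
    fix f c assume f: "f \<in> H"
    then show "(\<lambda>x. c * f x) \<in> H"
      using synth_mem[OF ell2_scale[OF coef_mem], of f c] by (simp add: synth_scale synth_coef)
    show "0 \<le> Re (ip f f)" unfolding ip_self by (intro infsum_nonneg) simp
  next
    fix f assume f: "f \<in> H" "ip f f = 0"
    have "coef f = (\<lambda>i. 0)"
    proof
      fix i
      have "(\<Sum>\<^sub>\<infinity>i\<in>I. (cmod (coef f i))\<^sup>2) \<le> 0" using f(2) ip_self[of f] by simp
      then show "coef f i = 0"
        using nonneg_infsum_le_0D[of "\<lambda>i. (cmod (coef f i))\<^sup>2" I i]
          ell2_summable[OF coef_mem[OF f(1)]] ell2_outside[OF coef_mem[OF f(1)], of i] by auto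
    qed
    with synth_coef[OF f(1)] zero show "f = (\<lambda>x. 0)" by simp
  next
    fix F :: "nat \<Rightarrow> 'a \<Rightarrow> complex"
    assume F: "\<And>n. F n \<in> H"
      and Cauchy_F: "\<And>e. e > 0 \<Longrightarrow> \<exists>M. \<forall>m\<ge>M. \<forall>n\<ge>M.
           sqrt (Re (ip (\<lambda>x. F m x - F n x) (\<lambda>x. F m x - F n x))) < e"
    obtain d where d: "d \<in> ell2 I"
      "(\<lambda>n. sqrt (\<Sum>\<^sub>\<infinity>i\<in>I. (cmod (coef (F n) i - d i))\<^sup>2)) \<longlonglongrightarrow> 0"
      using ell2_complete[of "\<lambda>n. coef (F n)" I] Cauchy_F coef_mem[OF F]
      unfolding ip_self by (auto simp: coef_diff F)
    then have "(\<lambda>n. sqrt (Re (ip (\<lambda>x. F n x - synth d x) (\<lambda>x. F n x - synth d x)))) \<longlonglongrightarrow> 0"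
      unfolding ip_self by (simp add: coef_diff F synth_mem)
    with d(1) synth_mem show "\<exists>f\<in>H. (\<lambda>n. sqrt (Re (ip (\<lambda>x. F n x - f x) (\<lambda>x. F n x - f x)))) \<longlonglongrightarrow> 0"
      by blast
  next
    fix y assume y: "y \<in> X"
    then show "(\<lambda>x. if x \<in> X then K x y else 0) \<in> H"
      by (simp add: kernel synth_mem kernel_coef)
    fix f assume f: "f \<in> H"
    have "f y = synth (coef f) y" using f by (simp add: synth_coef)
    also have "\<dots> = ip f (\<lambda>x. if x \<in> X then K x y else 0)"
      unfolding kernel[OF y] ip_def coef_synth[OF kernel_coef[OF y]] ell2_ip_def
      using y by (simp add: synth_def cong: infsum_cong)
    finally show "f y = ip f (\<lambda>x. if x \<in> X then K x y else 0)" .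
  qed
  then show ?thesis by blast
qed

section \<open>The Fourier expansion of the Korobov kernel\<close>

lemma zeta_real_summable_pos:
  assumes "\<beta> > 1"
  shows "summable (\<lambda>n. real (Suc n) powr (- \<beta>))" "zeta_real \<beta> > 0"
proof -
  show s: "summable (\<lambda>n. real (Suc n) powr (- \<beta>))"
    using assms summable_Suc_iff[of "\<lambda>n. real n powr (- \<beta>)"]
    by (simp add: summable_real_powr_iff)
  show "zeta_real \<beta> > 0"
    unfolding zeta_real_def by (intro suminf_pos s) simp
qed

lemma has_sum_int_powr:
  assumes "\<beta> > 1"
  shows "((\<lambda>h. \<bar>real_of_int h\<bar> powr (- \<beta>)) has_sum (2 * zeta_real \<beta>)) (UNIV - {0})"
proof -
  let ?f = "\<lambda>h::int. \<bar>real_of_int h\<bar> powr (- \<beta>)"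
  have nat: "((\<lambda>n. real (Suc n) powr (- \<beta>)) has_sum zeta_real \<beta>) UNIV"
    unfolding zeta_real_def
    by (intro sums_nonneg_imp_has_sum summable_sums zeta_real_summable_pos(1)[OF assms]) simp
  have pos: "(?f has_sum zeta_real \<beta>) {0<..}"
    using nat has_sum_reindex_bij_witness[of UNIV "\<lambda>h. nat h - 1" "\<lambda>n. int (Suc n)" "{0<..}" ?f
      "\<lambda>n. real (Suc n) powr (- \<beta>)" "zeta_real \<beta>" "zeta_real \<beta>"] by force
  have "(?f has_sum zeta_real \<beta>) {..<0}"
    using pos has_sum_reindex_bij_witness[of "{..<0}" uminus uminus "{0<..}" ?f ?f "zeta_real \<beta>" "zeta_real \<beta>"]
    by simp
  with pos have "(?f has_sum (zeta_real \<beta> + zeta_real \<beta>)) ({0<..} \<union> {..<0})"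
    by (intro has_sum_Un_disjoint) auto
  also have "{0<..} \<union> {..<0} = UNIV - {0::int}" by auto
  finally show ?thesis by simp
qed

lemma has_sum_prod_powr:
  assumes "\<beta> > 1" "finite u"
  shows "((\<lambda>h. \<Prod>j\<in>u. \<bar>real_of_int (h j)\<bar> powr (- \<beta>)) has_sum (2 * zeta_real \<beta>) ^ card u)
           (u \<rightarrow>\<^sub>E (UNIV - {0}))"
proof -
  let ?f = "\<lambda>h::int. \<bar>real_of_int h\<bar> powr (- \<beta>)"
  have "(\<Sum>\<^sub>\<infinity>h\<in>u \<rightarrow>\<^sub>E (UNIV - {0}). \<Prod>j\<in>u. ?f (h j)) = (\<Prod>j\<in>u. infsum ?f (UNIV - {0}))"
  proof (rule infsum_prod_PiE_abs[OF assms(2)])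
    show "(\<lambda>h. norm (?f h)) summable_on (UNIV - {0})"
      using has_sum_int_powr[OF assms(1)] by (simp add: has_sum_iff)
  qed
  also have "\<dots> = (2 * zeta_real \<beta>) ^ card u"
    using has_sum_int_powr[OF assms(1)] by (simp add: has_sum_iff)
  finally have eq: "(\<Sum>\<^sub>\<infinity>h\<in>u \<rightarrow>\<^sub>E (UNIV - {0}). \<Prod>j\<in>u. ?f (h j)) = (2 * zeta_real \<beta>) ^ card u" .
  \<comment> \<open>A non-summable family has \<open>infsum\<close> equal to the default 0, so a
    nonzero value certifies summability.\<close>
  moreover have "(2 * zeta_real \<beta>) ^ card u \<noteq> 0" using zeta_real_summable_pos(2)[OF assms(1)] by simp
  ultimately have "(\<lambda>h. \<Prod>j\<in>u. ?f (h j)) summable_on (u \<rightarrow>\<^sub>E (UNIV - {0}))"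
    using infsum_not_exists by fastforce
  with eq show ?thesis by (simp add: has_sum_iff)
qed

text \<open>The exponent is a parameter because the error involves \<alpha>, while the averaging
  argument works with \<alpha> times \<lambda>.\<close>

definition dual_sum :: "real \<Rightarrow> nat \<Rightarrow> nat set \<Rightarrow> (nat \<Rightarrow> int) \<Rightarrow> real" where
  "dual_sum \<beta> N u z =
     (\<Sum>\<^sub>\<infinity>h\<in>{h \<in> u \<rightarrow>\<^sub>E (UNIV - {0}). int N dvd (\<Sum>j\<in>u. h j * z j)}.
        \<Prod>j\<in>u. \<bar>of_int (h j)\<bar> powr (- \<beta>))"

text \<open>The pair \<open>(u, h)\<close> stands for the frequency vector in \<open>\<int>\<^sup>d\<close> with support \<open>u\<close>.\<close>

definition frequencies :: "nat \<Rightarrow> (nat set \<times> (nat \<Rightarrow> int)) set" where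
  "frequencies d = (SIGMA u:Pow {1..d}. u \<rightarrow>\<^sub>E (UNIV - {0}))"

definition character :: "nat set \<times> (nat \<Rightarrow> int) \<Rightarrow> (nat \<Rightarrow> real) \<Rightarrow> complex" where
  "character i x = cis (2 * pi * (\<Sum>j\<in>fst i. of_int (snd i j) * x j))"

text \<open>The coefficients of the Mercer expansion of the kernel. The empty support gets 1, since
  the kernel has its constant term outside the weighted sum.\<close>

definition korobov_weight :: "real \<Rightarrow> (nat set \<Rightarrow> real) \<Rightarrow> nat set \<times> (nat \<Rightarrow> int) \<Rightarrow> real" where
  "korobov_weight \<alpha> \<gamma> i =
     (if fst i = {} then 1 else \<gamma> (fst i)) * (\<Prod>j\<in>fst i. \<bar>of_int (snd i j)\<bar> powr (- \<alpha>))"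

lemma cmod_character [simp]: "cmod (character i x) = 1"
  by (simp add: character_def)

lemma character_mult_cnj:
  "character (u, h) x * cnj (character (u, h) y) = cis (2 * pi * (\<Sum>j\<in>u. of_int (h j) * (x j - y j)))"
  by (simp add: character_def cis_cnj cis_mult sum_subtractf right_diff_distrib)

section \<open>Absolute convergence of the kernel expansion\<close>

locale korobov =
  fixes d :: nat and \<alpha> :: real and \<gamma> :: "nat set \<Rightarrow> real"
  assumes \<alpha>: "\<alpha> > 1" and \<gamma>: "\<And>u. u \<subseteq> {1..d} \<Longrightarrow> \<gamma> u > 0"
begin

lemma korobov_weight_pos: "i \<in> frequencies d \<Longrightarrow> korobov_weight \<alpha> \<gamma> i > 0"
  unfolding korobov_weight_def frequencies_def
  by (intro mult_pos_pos prod_pos) (auto simp: \<gamma> dest: PiE_mem)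

lemma korobov_weight_has_sum_fibre:
  assumes "u \<subseteq> {1..d}"
  shows "((\<lambda>h. korobov_weight \<alpha> \<gamma> (u, h)) has_sum
           (if u = {} then 1 else \<gamma> u) * (2 * zeta_real \<alpha>) ^ card u) (u \<rightarrow>\<^sub>E (UNIV - {0}))"
  unfolding korobov_weight_def fst_conv snd_conv
  using assms finite_subset by (intro has_sum_cmult_right has_sum_prod_powr \<alpha>) auto

lemma korobov_weight_summable: "korobov_weight \<alpha> \<gamma> summable_on frequencies d"
  unfolding frequencies_def
proof (rule summable_on_SigmaI)
  show "((\<lambda>h. korobov_weight \<alpha> \<gamma> (u, h)) has_sum
           (if u = {} then 1 else \<gamma> u) * (2 * zeta_real \<alpha>) ^ card u) (u \<rightarrow>\<^sub>E (UNIV - {0}))"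
    if "u \<in> Pow {1..d}" for u
    using that by (intro korobov_weight_has_sum_fibre) auto
  show "korobov_weight \<alpha> \<gamma> (u, h) \<ge> 0" if "u \<in> Pow {1..d}" "h \<in> u \<rightarrow>\<^sub>E (UNIV - {0})" for u h
    using that by (intro less_imp_le korobov_weight_pos) (auto simp: frequencies_def)
qed simp

text \<open>The constant function \<open>undefined\<close> is the only extensional function on the
  empty set, so it represents the zero frequency.\<close>

lemma infsum_frequencies:
  fixes f :: "nat set \<times> (nat \<Rightarrow> int) \<Rightarrow> 'a::{banach}"
  assumes "f summable_on frequencies d"
  shows "infsum f (frequencies d) =
    f ({}, \<lambda>_. undefined) + (\<Sum>u\<in>Pow {1..d} - {{}}. \<Sum>\<^sub>\<infinity>h\<in>u \<rightarrow>\<^sub>E (UNIV - {0}). f (u, h))"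
proof -
  have "infsum f (frequencies d) = (\<Sum>\<^sub>\<infinity>u\<in>Pow {1..d}. \<Sum>\<^sub>\<infinity>h\<in>u \<rightarrow>\<^sub>E (UNIV - {0}). f (u, h))"
    using assms unfolding frequencies_def by (intro infsum_Sigma_banach[symmetric])
  also have "\<dots> = (\<Sum>u\<in>Pow {1..d}. \<Sum>\<^sub>\<infinity>h\<in>u \<rightarrow>\<^sub>E (UNIV - {0}). f (u, h))"
    by simp
  also have "\<dots> = (\<Sum>\<^sub>\<infinity>h\<in>{} \<rightarrow>\<^sub>E (UNIV - {0}). f ({}, h)) +
      (\<Sum>u\<in>Pow {1..d} - {{}}. \<Sum>\<^sub>\<infinity>h\<in>u \<rightarrow>\<^sub>E (UNIV - {0}). f (u, h))"
    by (subst sum.remove[of _ "{}"]) auto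
  finally show ?thesis by simp
qed

lemma weighted_summable:
  assumes "\<And>i. i \<in> frequencies d \<Longrightarrow> cmod (f i) \<le> 1"
  shows "(\<lambda>i. cmod (of_real (korobov_weight \<alpha> \<gamma> i) * f i)) summable_on frequencies d"
  using korobov_weight_summable
proof (rule summable_on_comparison_test)
  fix i assume i: "i \<in> frequencies d"
  show "cmod (of_real (korobov_weight \<alpha> \<gamma> i) * f i) \<le> korobov_weight \<alpha> \<gamma> i"
    using assms[OF i] korobov_weight_pos[OF i] by (simp add: norm_mult mult_left_le)
qed auto

text \<open>Merging supports and frequencies into one sum gives the form needed for the feature map
  and for termwise integration; absolute summability justifies the regrouping.\<close>

lemma korobov_kernel_eq:
  "korobov_kernel d \<alpha> \<gamma> x y = (\<Sum>\<^sub>\<infinity>i\<in>frequencies d.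
     of_real (korobov_weight \<alpha> \<gamma> i) * (character i x * cnj (character i y)))"
proof -
  let ?f = "\<lambda>i. of_real (korobov_weight \<alpha> \<gamma> i) * (character i x * cnj (character i y))"
  have "?f summable_on frequencies d"
    by (rule abs_summable_summable[OF weighted_summable]) (simp add: norm_mult)
  then have "infsum ?f (frequencies d) =
    ?f ({}, \<lambda>_. undefined) + (\<Sum>u\<in>Pow {1..d} - {{}}. \<Sum>\<^sub>\<infinity>h\<in>u \<rightarrow>\<^sub>E (UNIV - {0}). ?f (u, h))"
    by (rule infsum_frequencies)
  also have "?f ({}, \<lambda>_. undefined) = 1"
    by (simp add: korobov_weight_def character_def)
  finally have eq: "infsum ?f (frequencies d) =
    1 + (\<Sum>u\<in>Pow {1..d} - {{}}. \<Sum>\<^sub>\<infinity>h\<in>u \<rightarrow>\<^sub>E (UNIV - {0}). ?f (u, h))" .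
  have fibre: "(\<Sum>\<^sub>\<infinity>h\<in>u \<rightarrow>\<^sub>E (UNIV - {0}). ?f (u, h)) = of_real (\<gamma> u) *
       (\<Sum>\<^sub>\<infinity>h\<in>u \<rightarrow>\<^sub>E (UNIV - {0 :: int}).
          exp (2 * of_real pi * \<i> * of_real (\<Sum>j\<in>u. of_int (h j) * (x j - y j)))
          / of_real (\<Prod>j\<in>u. \<bar>of_int (h j)\<bar> powr \<alpha>))" if "u \<in> Pow {1..d} - {{}}" for u
    unfolding infsum_cmult_right'[symmetric]
    using that by (intro infsum_cong)
      (simp add: character_mult_cnj korobov_weight_def cis_conv_exp powr_minus prod_inversef[symmetric]
        divide_inverse mult_ac)
  show ?thesis
    unfolding korobov_kernel_def eq by (intro arg_cong2[of _ _ _ _ "(+)"] sum.cong refl fibre[symmetric])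
qed

end

section \<open>Averaging dual sums over the candidates\<close>

text \<open>Being coprime to \<open>b ^ m\<close> and to \<open>b ^ k\<close> both mean not being
  divisible by \<open>b\<close>, so the candidates are the totatives of \<open>b ^ k\<close>,
  \<open>b ^ (k - 1) * (b - 1)\<close> in number.\<close>

lemma card_coprime_int:
  assumes "prime b" "0 < k" "k \<le> m"
  shows "b ^ k \<le> 2 * card {c \<in> {1..int b ^ k - 1}. gcd c (int b ^ m) = 1}" (is "_ \<le> 2 * card ?Z")
proof -
  have b: "b \<ge> 2" using assms(1) by (rule prime_ge_2_nat)
  have "?Z = int ` totatives (b ^ k)"
  proof (intro set_eqI iffI)
    fix c assume "c \<in> ?Z"
    then have c: "1 \<le> c" "c < int b ^ k" "coprime c (int b ^ m)" by (auto simp: coprime_iff_gcd_eq_1)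
    then have "coprime c (int b ^ k)" using assms by (simp add: coprime_power_right_iff)
    then have "nat c \<in> totatives (b ^ k)" using c
      by (auto simp: in_totatives_iff coprime_int_iff[symmetric] nat_le_iff)
    then show "c \<in> int ` totatives (b ^ k)" using c by (intro image_eqI[of _ _ "nat c"]) auto
  next
    fix c assume "c \<in> int ` totatives (b ^ k)"
    then obtain a where a: "c = int a" "0 < a" "a \<le> b ^ k" "coprime a (b ^ k)"
      by (auto simp: in_totatives_iff)
    \<comment> \<open>Totatives range up to \<open>b ^ k\<close> inclusive, candidates only up to
      \<open>b ^ k - 1\<close>; the end point is not coprime to itself since
      \<open>k > 0\<close>.\<close>
    have "a \<noteq> b ^ k" using a(4) assms b by auto
    then have "int a < int (b ^ k)" using a(3) by (simp only: of_nat_less_iff)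
    moreover have "coprime (int a) (int b ^ m)"
      using a(4) assms by (simp add: coprime_power_right_iff flip: coprime_int_iff)
    then have "gcd (int a) (int b ^ m) = 1" by (simp only: coprime_iff_gcd_eq_1)
    ultimately show "c \<in> ?Z" using a(1,2) by simp
  qed
  then have "card ?Z = totient (b ^ k)" by (simp add: card_image totient_def)
  also have "\<dots> = b ^ (k - 1) * (b - 1)" using assms by (simp add: totient_prime_power)
  finally have "2 * card ?Z = b ^ (k - 1) * (2 * (b - 1))" by simp
  also have "\<dots> \<ge> b ^ (k - 1) * b" using b by (intro mult_le_mono2) linarith
  also have "b ^ (k - 1) * b = b ^ k" using assms by (cases k) auto
  finally show ?thesis .
qed

text \<open>Modulo \<open>M\<close>, \<open>A\<close> is \<open>h\<close> times a unit, and units do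
  not change the gcd with \<open>M\<close>. In particular one unit solution already forces
  \<open>gcd A M\<close> to divide \<open>h\<close>.\<close>

lemma gcd_dvd_of_coprime_solution:
  fixes A h c M :: int
  assumes "M dvd A + h * c" "coprime c M"
  shows "gcd h M = gcd A M"
proof -
  obtain k where "A + h * c = M * k" using assms(1) by (auto simp: dvd_def)
  then have "A = k * M + - (h * c)" by (simp add: algebra_simps)
  then have "gcd M A = gcd M (- (h * c))" by (simp only: gcd_add_mult)
  also have "\<dots> = gcd M h"
    using assms(2) by (simp add: gcd_mult_right_right_cancel coprime_commute)
  finally show ?thesis by (simp add: gcd.commute)
qed

text \<open>Two solutions differ by a multiple of \<open>M / gcd A M\<close>.\<close>

lemma card_solutions_le:
  fixes A h M :: int
  assumes "M > 0" "\<And>c. c \<in> Z \<Longrightarrow> coprime c M" "Z \<subseteq> {0..<M}"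
  shows "int (card {c \<in> Z. M dvd A + h * c}) \<le> gcd A M"
proof (cases "{c \<in> Z. M dvd A + h * c} = {}")
  case False
  then obtain c0 where c0: "c0 \<in> Z" "M dvd A + h * c0" by blast
  define g where "g = gcd A M"
  define q where "q = M div g"
  have g: "g > 0" using assms(1) by (simp add: g_def)
  have M: "M = g * q" by (simp add: q_def g_def)
  have q: "q > 0" using M g assms(1) by (simp add: zero_less_mult_iff)
  have gh: "gcd h M = g" unfolding g_def by (rule gcd_dvd_of_coprime_solution[OF c0(2) assms(2)[OF c0(1)]])
  have cong: "c mod q = c0 mod q" if c: "c \<in> Z" "M dvd A + h * c" for c
  proof -
    have "M dvd (A + h * c) - (A + h * c0)" using c(2) c0(2) by (rule dvd_diff)
    then have "g * q dvd h * (c - c0)" by (simp add: M[symmetric] right_diff_distrib)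
    moreover have "h = g * (h div g)" using gh by (metis dvd_mult_div_cancel gcd_dvd1)
    ultimately have "q dvd (h div g) * (c - c0)"
      using g by (metis dvd_mult_cancel_left mult.assoc less_irrefl)
    moreover have "coprime (h div g) q"
      unfolding q_def using gh g div_gcd_coprime[of h M] by auto
    ultimately have "q dvd c - c0" by (simp add: coprime_commute coprime_dvd_mult_right_iff)
    then show ?thesis by (rule mod_eq_dvd_iff[THEN iffD2])
  qed
  \<comment> \<open>All solutions share their remainder modulo \<open>q\<close>, so each is
    determined by its quotient, and below \<open>M = g * q\<close> only \<open>g\<close> quotients
    occur.\<close>
  have "inj_on (\<lambda>c. c div q) {c \<in> Z. M dvd A + h * c}"
  proof (rule inj_onI)
    fix c c' assume "c \<in> {c \<in> Z. M dvd A + h * c}" "c' \<in> {c \<in> Z. M dvd A + h * c}" "c div q = c' div q"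
    then show "c = c'" using cong[of c] cong[of c'] by (metis mem_Collect_eq mult_div_mod_eq)
  qed
  moreover have "(\<lambda>c. c div q) ` {c \<in> Z. M dvd A + h * c} \<subseteq> {0..<g}"
  proof safe
    fix c assume "c \<in> Z"
    then have c: "0 \<le> c" "c < g * q" using assms(3) M by auto
    have "c div q * q \<le> c" using div_mult_mod_eq[of c q] pos_mod_sign[OF q, of c] by linarith
    then have "c div q * q < g * q" using c(2) by linarith
    then show "c div q \<in> {0..<g}" using c(1) q by (simp add: pos_imp_zdiv_nonneg_iff)
  qed
  ultimately have "card {c \<in> Z. M dvd A + h * c} \<le> card {0..<g}"
    by (rule card_inj_on_le) simp
  also have "card {0..<g} = nat g" by simp
  finally have "int (card {c \<in> Z. M dvd A + h * c}) \<le> g" using g by linarith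
  then show ?thesis by (simp only: g_def)
next
  case True
  then show ?thesis by (simp only: card.empty) simp
qed

lemma card_solutions_density_le:
  fixes A h M :: int
  assumes "M > 0" "\<And>c. c \<in> Z \<Longrightarrow> coprime c M" "Z \<subseteq> {0..<M}" "M \<le> 2 * int (card Z)"
  shows "int (card {c \<in> Z. M dvd A + h * c}) * M \<le> 2 * gcd A M * int (card Z)"
proof -
  have "int (card {c \<in> Z. M dvd A + h * c}) * M \<le> gcd A M * (2 * int (card Z))"
    by (rule mult_mono[OF card_solutions_le[OF assms(1-3)] assms(4)]) (use assms(1) in auto)
  then show ?thesis by simp
qed

text \<open>Writing \<open>h = g * q\<close> pulls out the factor \<open>g powr - \<beta>\<close>;
  together with the leading \<open>g\<close> it is at most 1, because \<open>g \<ge> 1\<close> and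
  \<open>\<beta> > 1\<close>.\<close>

lemma sum_powr_multiples_le:
  assumes "\<beta> > 1" "g > 0" "finite F" "F \<subseteq> {h. h \<noteq> 0 \<and> g dvd h}"
  shows "of_int g * (\<Sum>h\<in>F. \<bar>real_of_int h\<bar> powr (- \<beta>)) \<le> 2 * zeta_real \<beta>"
proof -
  have "(\<Sum>h\<in>F. \<bar>real_of_int h\<bar> powr (- \<beta>)) =
      (\<Sum>h\<in>F. of_int g powr (- \<beta>) * \<bar>real_of_int (h div g)\<bar> powr (- \<beta>))"
  proof (rule sum.cong[OF refl])
    fix h assume "h \<in> F"
    then obtain q where "h = g * q" using assms(4) by (auto simp: dvd_def)
    then show "\<bar>real_of_int h\<bar> powr (- \<beta>) = of_int g powr (- \<beta>) * \<bar>real_of_int (h div g)\<bar> powr (- \<beta>)"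
      using assms(2) by (simp add: abs_mult powr_mult)
  qed
  also have "\<dots> = of_int g powr (- \<beta>) * (\<Sum>q\<in>(\<lambda>h. h div g) ` F. \<bar>real_of_int q\<bar> powr (- \<beta>))"
  proof -
    have "inj_on (\<lambda>h. h div g) F"
      using assms(4) by (intro inj_onI) (metis (mono_tags, lifting) dvd_mult_div_cancel mem_Collect_eq subsetD)
    then show ?thesis by (simp add: sum.reindex sum_distrib_left)
  qed
  also have "\<dots> \<le> of_int g powr (- \<beta>) * (2 * zeta_real \<beta>)"
  proof (rule mult_left_mono)
    show "(\<Sum>q\<in>(\<lambda>h. h div g) ` F. \<bar>real_of_int q\<bar> powr (- \<beta>)) \<le> 2 * zeta_real \<beta>"
      using assms by (intro finite_sum_le_has_sum[OF has_sum_int_powr[OF assms(1)]])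
        (auto simp: dvd_def)
  qed simp
  finally have "of_int g * (\<Sum>h\<in>F. \<bar>real_of_int h\<bar> powr (- \<beta>)) \<le>
      of_int g * (of_int g powr (- \<beta>) * (2 * zeta_real \<beta>))"
    using assms(2) by (intro mult_left_mono) auto
  also have "\<dots> = of_int g powr (1 - \<beta>) * (2 * zeta_real \<beta>)"
    using assms(2) by (simp add: powr_diff powr_minus divide_inverse)
  also have "\<dots> \<le> 1 * (2 * zeta_real \<beta>)"
  proof (rule mult_right_mono)
    have "real_of_int g powr (1 - \<beta>) \<le> real_of_int g powr 0"
      using assms by (intro powr_mono) auto
    then show "real_of_int g powr (1 - \<beta>) \<le> 1" using assms(2) by simp
  qed (use zeta_real_summable_pos(2)[OF assms(1)] in simp)
  finally show ?thesis by simp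
qed

text \<open>Only multiples \<open>h\<close> of \<open>gcd A M\<close> contribute, and the factor \<open>gcd A M\<close> lost in counting the
  solutions \<open>c\<close> is regained from the size of these \<open>h\<close>.\<close>

lemma sum_count_solutions_le:
  fixes A M :: int
  assumes "\<beta> > 1" "M > 0" "\<And>c. c \<in> Z \<Longrightarrow> coprime c M" "Z \<subseteq> {0..<M}" "M \<le> 2 * int (card Z)"
    and "finite F" "F \<subseteq> UNIV - {0}"
  shows "(\<Sum>h\<in>F. \<bar>real_of_int h\<bar> powr (- \<beta>) * real (card {c \<in> Z. M dvd A + h * c})) \<le>
    real (card Z) * (2 * (2 * zeta_real \<beta>) / of_int M)"
proof -
  let ?g = "gcd A M" and ?n = "\<lambda>h. card {c \<in> Z. M dvd A + h * c}"
  define C where "C = 2 * real (card Z) / of_int M"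
  have n_le: "real (?n h) \<le> C * of_int ?g" for h
  proof -
    have "real_of_int (int (?n h) * M) \<le> of_int (2 * ?g * int (card Z))"
      by (intro of_int_le_iff[THEN iffD2] card_solutions_density_le assms)
    then show ?thesis using assms(2) by (simp add: C_def field_simps)
  qed
  have n_0: "?n h = 0" if "\<not> ?g dvd h" for h
  proof -
    have "{c \<in> Z. M dvd A + h * c} = {}"
      using that gcd_dvd_of_coprime_solution assms(3) by (metis (mono_tags, lifting) Collect_empty_eq gcd_dvd1)
    then show ?thesis by (simp only: card.empty)
  qed
  have "(\<Sum>h\<in>F. \<bar>real_of_int h\<bar> powr (- \<beta>) * real (?n h)) =
      (\<Sum>h\<in>{h\<in>F. ?g dvd h}. \<bar>real_of_int h\<bar> powr (- \<beta>) * real (?n h))"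
    using assms n_0 by (intro sum.mono_neutral_right) auto
  also have "\<dots> \<le> (\<Sum>h\<in>{h\<in>F. ?g dvd h}. \<bar>real_of_int h\<bar> powr (- \<beta>) * (C * of_int ?g))"
    by (intro sum_mono mult_left_mono n_le) auto
  also have "\<dots> = C * (of_int ?g * (\<Sum>h\<in>{h\<in>F. ?g dvd h}. \<bar>real_of_int h\<bar> powr (- \<beta>)))"
    by (simp add: sum_distrib_left mult_ac)
  also have "\<dots> \<le> C * (2 * zeta_real \<beta>)"
    using assms by (intro mult_left_mono sum_powr_multiples_le) (auto simp: C_def)
  finally show ?thesis by (simp add: C_def mult_ac)
qed

text \<open>Keeps index sets in the form \<open>{1..d}\<close>.\<close>

declare One_nat_def [simp del]

section \<open>Exchange of sums and subadditivity of powers\<close>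

lemma infsum_finite_sum:
  fixes f :: "'k \<Rightarrow> 'i \<Rightarrow> 'a :: {topological_comm_monoid_add, t2_space}"
  assumes "finite A" "\<And>k. k \<in> A \<Longrightarrow> f k summable_on I"
  shows "(\<Sum>k\<in>A. infsum (f k) I) = (\<Sum>\<^sub>\<infinity>i\<in>I. \<Sum>k\<in>A. f k i)"
proof -
  have "((\<lambda>i. \<Sum>k\<in>A. f k i) has_sum (\<Sum>k\<in>A. infsum (f k) I)) I"
    using assms by (induction A rule: finite_induct) (auto intro!: has_sum_add)
  then show ?thesis by (simp add: infsumI)
qed

text \<open>The fractions \<open>x / s\<close> and \<open>y / s\<close> lie in the unit interval and
  add up to 1, and there \<open>t \<le> t powr l\<close>.\<close>

lemma powr_add_le:
  fixes x y :: real
  assumes "0 < l" "l \<le> 1" "x \<ge> 0" "y \<ge> 0"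
  shows "(x + y) powr l \<le> x powr l + y powr l"
proof (cases "x + y = 0")
  case False
  define s where "s = x + y"
  have s: "s > 0" using False assms by (simp add: s_def)
  have *: "s powr l * (t / s) \<le> t powr l" if "0 \<le> t" "t \<le> s" for t
  proof -
    have "t / s \<le> (t / s) powr l"
      using powr_mono'[of l 1 "t / s"] that s assms by simp
    then have "s powr l * (t / s) \<le> s powr l * (t / s) powr l" by (intro mult_left_mono) auto
    also have "\<dots> = t powr l" using that s by (simp add: powr_divide)
    finally show ?thesis .
  qed
  have "s powr l = s powr l * (x / s) + s powr l * (y / s)"
    using s by (simp add: s_def add_divide_distrib[symmetric] distrib_left[symmetric])
  then show ?thesis using *[of x] *[of y] assms by (simp add: s_def)
qed (use assms in simp)

lemma sum_powr_le_powr_sum: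
  fixes f :: "'i \<Rightarrow> real"
  assumes "0 < l" "l \<le> 1" "finite F" "\<And>i. i \<in> F \<Longrightarrow> f i \<ge> 0"
  shows "(\<Sum>i\<in>F. f i) powr l \<le> (\<Sum>i\<in>F. f i powr l)"
  using assms(3,4)
proof (induction F rule: finite_induct)
  case (insert i F)
  have "(f i + sum f F) powr l \<le> f i powr l + sum f F powr l"
    using insert assms(1,2) by (intro powr_add_le) (auto intro: sum_nonneg)
  also have "\<dots> \<le> f i powr l + (\<Sum>i\<in>F. f i powr l)"
    using insert by simp
  finally show ?case using insert by simp
qed simp

text \<open>The finite inequality raised to the power \<open>1 / l\<close> bounds all partial sums
  of \<open>f\<close> by one constant, which yields summability of \<open>f\<close> and the estimate
  together.\<close>

lemma infsum_powr_le:
  fixes f :: "'i \<Rightarrow> real"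
  assumes "0 < l" "l \<le> 1" "\<And>i. i \<in> I \<Longrightarrow> f i \<ge> 0" "(\<lambda>i. f i powr l) summable_on I"
  shows "(\<Sum>\<^sub>\<infinity>i\<in>I. f i) powr l \<le> (\<Sum>\<^sub>\<infinity>i\<in>I. f i powr l)"
proof -
  define S where "S = (\<Sum>\<^sub>\<infinity>i\<in>I. f i powr l)"
  have S: "S \<ge> 0" unfolding S_def by (intro infsum_nonneg) simp
  have fin: "sum f F \<le> S powr (1 / l)" if F: "finite F" "F \<subseteq> I" for F
  proof -
    have nonneg: "sum f F \<ge> 0" using F assms(3) by (intro sum_nonneg) auto
    have "sum f F powr l \<le> (\<Sum>i\<in>F. f i powr l)"
      using F assms by (intro sum_powr_le_powr_sum) auto
    also have "\<dots> \<le> S" unfolding S_def using F assms(4) by (intro finite_sum_le_infsum) auto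
    finally have "(sum f F powr l) powr (1 / l) \<le> S powr (1 / l)"
      using assms(1) by (intro powr_mono2) auto
    then show ?thesis using nonneg assms(1) by (simp add: powr_powr)
  qed
  have "f summable_on I"
    using fin assms(3) by (intro nonneg_bdd_above_summable_on bdd_aboveI2) auto
  then have "infsum f I \<le> S powr (1 / l)" using fin by (rule infsum_le_finite_sums)
  then have "infsum f I powr l \<le> (S powr (1 / l)) powr l"
    using assms by (intro powr_mono2 infsum_nonneg) auto
  then show ?thesis using S assms(1) by (simp add: powr_powr S_def)
qed

section \<open>Bounds and averages for dual sums\<close>

lemma prod_powr_summable:
  assumes "\<beta> > 1" "finite u" "D \<subseteq> u \<rightarrow>\<^sub>E (UNIV - {0})"
  shows "(\<lambda>h. \<Prod>j\<in>u. \<bar>real_of_int (h j)\<bar> powr (- \<beta>)) summable_on D"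
  using has_sum_prod_powr[OF assms(1,2)] assms(3) by (meson has_sum_imp_summable summable_on_subset_banach)

lemma dual_sum_nonneg: "dual_sum \<beta> N u z \<ge> 0"
  unfolding dual_sum_def by (intro infsum_nonneg prod_nonneg) simp

text \<open>Obtained by dropping the congruence. It serves the components with
  \<open>w \<ge> m\<close>, whose denominator is \<open>b ^ 0\<close>.\<close>

lemma dual_sum_le:
  assumes "\<beta> > 1" "finite u"
  shows "dual_sum \<beta> N u z \<le> (2 * zeta_real \<beta>) ^ card u"
proof -
  have "dual_sum \<beta> N u z \<le> (\<Sum>\<^sub>\<infinity>h\<in>u \<rightarrow>\<^sub>E (UNIV - {0}). \<Prod>j\<in>u. \<bar>real_of_int (h j)\<bar> powr (- \<beta>))"
    unfolding dual_sum_def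
    by (intro infsum_mono2 prod_powr_summable assms prod_nonneg) auto
  then show ?thesis using has_sum_prod_powr[OF assms] by (simp add: infsumI)
qed

text \<open>The inequality often called Jensen's: the power moves inside the sum and multiplies the
  exponent. The condition \<open>\<beta> * l > 1\<close>, that is \<lambda> > 1/\<alpha>, keeps the
  right side convergent.\<close>

lemma dual_sum_powr_le:
  assumes "0 < l" "l \<le> 1" "\<beta> * l > 1" "finite u"
  shows "dual_sum \<beta> N u z powr l \<le> dual_sum (\<beta> * l) N u z"
proof -
  have eq: "(\<Prod>j\<in>u. \<bar>real_of_int (h j)\<bar> powr (- \<beta>)) powr l = (\<Prod>j\<in>u. \<bar>real_of_int (h j)\<bar> powr (- (\<beta> * l)))" for h
    by (simp add: prod_powr_distrib powr_powr)
  show ?thesis unfolding dual_sum_def eq[symmetric]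
    by (rule infsum_powr_le[OF assms(1,2)])
      (auto intro!: prod_nonneg prod_powr_summable assms simp: eq)
qed

lemma dual_sum_cong:
  "(\<And>j. j \<in> u \<Longrightarrow> z j = z' j) \<Longrightarrow> dual_sum \<beta> N u z = dual_sum \<beta> N u z'"
  unfolding dual_sum_def by (simp cong: sum.cong)

text \<open>Fix the frequencies on \<open>v\<close> and let \<open>A\<close> be their share of the
  congruence \<open>A + y * Y * c \<equiv> 0\<close> modulo \<open>Y * M\<close>. If
  \<open>Y\<close> does not divide \<open>A\<close>, there is no solution; otherwise dividing by
  \<open>Y\<close> leaves a congruence modulo \<open>M\<close>, to which
  \<open>sum_count_solutions_le\<close> applies. The resulting bound does not depend on
  \<open>A\<close>, so summing over \<open>v\<close> contributes the full zeta power.\<close>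

lemma sum_dual_sum_le:
  fixes Y M N :: nat and Z :: "int set"
  assumes "\<beta> > 1" "finite v" "e \<notin> v" "Y > 0" "M > 0" "N = Y * M"
    and Z: "\<And>c. c \<in> Z \<Longrightarrow> coprime c (int M)" "Z \<subseteq> {0..<int M}" "int M \<le> 2 * int (card Z)"
  shows "(\<Sum>c\<in>Z. dual_sum \<beta> N (insert e v) (z(e := int Y * c))) \<le>
    real (card Z) * (2 * (2 * zeta_real \<beta>) ^ card (insert e v) / real M)"
proof -
  let ?u = "insert e v"
  let ?P = "?u \<rightarrow>\<^sub>E (UNIV - {0 :: int})"
  let ?r = "\<lambda>u h. \<Prod>j\<in>u. \<bar>real_of_int (h j)\<bar> powr (- \<beta>)"
  let ?D = "\<lambda>h c. int N dvd (\<Sum>j\<in>?u. h j * (z(e := int Y * c)) j)"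
  define A where "A h = (\<Sum>j\<in>v. h j * z j)" for h :: "nat \<Rightarrow> int"
  define G where "G h y = ?r v h * (\<bar>real_of_int y\<bar> powr (- \<beta>) *
      real (card {c \<in> Z. int N dvd A h + y * (int Y * c)}))" for h y
  have G_nonneg: "G h y \<ge> 0" for h y
    unfolding G_def by (intro mult_nonneg_nonneg prod_nonneg) auto
  define C where "C = real (card Z) * (2 * (2 * zeta_real \<beta>) / real M)"
  have finZ: "finite Z" using Z(2) finite_subset by blast
  have C: "C \<ge> 0" using zeta_real_summable_pos(2)[OF assms(1)] by (simp add: C_def)
  have sum_split: "(\<Sum>j\<in>?u. h j * (z(e := int Y * c)) j) = A h + h e * (int Y * c)" for h c
    using assms(2,3) by (simp add: A_def add.commute cong: sum.cong) (auto intro!: sum.cong)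
  have inner: "(\<Sum>y\<in>F. \<bar>real_of_int y\<bar> powr (- \<beta>) *
      real (card {c \<in> Z. int N dvd A h + y * (int Y * c)})) \<le> C"
    if F: "finite F" "F \<subseteq> UNIV - {0}" for F h
  proof (cases "int Y dvd A h")
    case True
    then obtain a where a: "A h = int Y * a" by (auto simp: dvd_def)
    have "int N dvd A h + y * (int Y * c) \<longleftrightarrow> int M dvd a + y * c" for y c
    proof -
      have "A h + y * (int Y * c) = int Y * (a + y * c)" by (simp add: a algebra_simps)
      then show ?thesis using assms(4,6) by simp
    qed
    then show ?thesis
      using sum_count_solutions_le[OF assms(1) _ Z F, of a] assms(5) by (simp add: C_def)
  next
    case False
    have "{c \<in> Z. int N dvd A h + y * (int Y * c)} = {}" for y
    proof -
      have "\<not> int N dvd A h + y * (int Y * c)" for c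
      proof
        assume "int N dvd A h + y * (int Y * c)"
        then have "int Y dvd A h + int Y * (y * c)" using assms(6) by (simp add: dvd_mult_left mult_ac)
        with False show False by (simp add: dvd_add_left_iff)
      qed
      then show ?thesis by simp
    qed
    then show ?thesis using C by (simp only: card.empty) simp
  qed
  \<comment> \<open>Moving the congruence from the index set into the summand gives all
    \<open>c\<close> the same index set, after which the sums can be exchanged.\<close>
  have "(\<Sum>c\<in>Z. dual_sum \<beta> N ?u (z(e := int Y * c))) = (\<Sum>c\<in>Z. \<Sum>\<^sub>\<infinity>h\<in>?P. if ?D h c then ?r ?u h else 0)"
    unfolding dual_sum_def by (intro sum.cong refl infsum_cong_neutral) auto
  also have "\<dots> = (\<Sum>\<^sub>\<infinity>h\<in>?P. \<Sum>c\<in>Z. if ?D h c then ?r ?u h else 0)"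
  proof (rule infsum_finite_sum[OF finZ])
    have "?r ?u summable_on ?P" using assms by (intro prod_powr_summable) auto
    then show "(\<lambda>h. if ?D h c then ?r ?u h else 0) summable_on ?P" for c
      by (rule summable_on_comparison_test) (auto intro!: prod_nonneg)
  qed
  also have "\<dots> = (\<Sum>\<^sub>\<infinity>h\<in>?P. G (restrict h v) (h e))"
  proof (rule infsum_cong)
    fix h
    have "(\<Sum>c\<in>Z. if ?D h c then ?r ?u h else 0) = ?r ?u h * real (card {c \<in> Z. ?D h c})"
      using finZ by (simp add: sum.If_cases Int_def conj_commute)
    also have "\<dots> = G (restrict h v) (h e)"
      unfolding G_def sum_split using assms(2,3) by (simp add: A_def mult_ac)
    finally show "(\<Sum>c\<in>Z. if ?D h c then ?r ?u h else 0) = G (restrict h v) (h e)" .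
  qed
  also have "\<dots> \<le> (2 * zeta_real \<beta>) ^ card v * C"
  proof -
    \<comment> \<open>A finite set of frequencies is enlarged to a rectangle of its projections to
      \<open>v\<close> and to \<open>e\<close>. The terms are nonnegative, so this only increases
      the sum, and on a rectangle the bound \<open>inner\<close> applies to each row.\<close>
    have fin: "(\<Sum>h\<in>F. G (restrict h v) (h e)) \<le> (2 * zeta_real \<beta>) ^ card v * C"
      if F: "finite F" "F \<subseteq> ?P" for F
    proof -
      let ?F1 = "(\<lambda>h. restrict h v) ` F" and ?F2 = "(\<lambda>h. h e) ` F"
      have F1: "?F1 \<subseteq> v \<rightarrow>\<^sub>E (UNIV - {0})" and F2: "?F2 \<subseteq> UNIV - {0}"
        using F(2) by (force simp: restrict_PiE_iff PiE_iff subset_iff)+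
      have "inj_on (\<lambda>h. (restrict h v, h e)) F"
      proof (rule inj_onI)
        fix h h' assume hh: "h \<in> F" "h' \<in> F" "(restrict h v, h e) = (restrict h' v, h' e)"
        show "h = h'"
        proof (rule PiE_ext)
          show "h \<in> ?P" "h' \<in> ?P" using hh F by auto
          fix j assume "j \<in> ?u"
          then show "h j = h' j" using hh(3) by (auto dest: fun_cong[where x = j])
        qed
      qed
      then have "(\<Sum>h\<in>F. G (restrict h v) (h e)) =
          (\<Sum>x\<in>(\<lambda>h. (restrict h v, h e)) ` F. G (fst x) (snd x))"
        by (simp add: sum.reindex)
      also have "\<dots> \<le> (\<Sum>x\<in>?F1 \<times> ?F2. G (fst x) (snd x))"
        using F by (intro sum_mono2) (auto intro: G_nonneg)
      also have "\<dots> = (\<Sum>h\<in>?F1. \<Sum>y\<in>?F2. G h y)"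
        by (simp add: sum.cartesian_product case_prod_beta)
      also have "\<dots> \<le> (\<Sum>h\<in>?F1. ?r v h * C)"
      proof (rule sum_mono)
        fix h
        have "(\<Sum>y\<in>?F2. G h y) = ?r v h * (\<Sum>y\<in>?F2. \<bar>real_of_int y\<bar> powr (- \<beta>) *
            real (card {c \<in> Z. int N dvd A h + y * (int Y * c)}))"
          by (simp add: G_def sum_distrib_left)
        also have "\<dots> \<le> ?r v h * C"
          using F(1) F2 by (intro mult_left_mono inner prod_nonneg) auto
        finally show "(\<Sum>y\<in>?F2. G h y) \<le> ?r v h * C" .
      qed
      also have "\<dots> = (\<Sum>h\<in>?F1. ?r v h) * C" by (simp add: sum_distrib_right)
      also have "\<dots> \<le> (2 * zeta_real \<beta>) ^ card v * C"
        using F(1) F1 by (intro mult_right_mono[OF _ C]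
          finite_sum_le_has_sum[OF has_sum_prod_powr[OF assms(1,2)]] prod_nonneg) auto
      finally show ?thesis .
    qed
    have "(\<lambda>h. G (restrict h v) (h e)) summable_on ?P"
    proof (rule nonneg_bdd_above_summable_on)
      show "bdd_above (sum (\<lambda>h. G (restrict h v) (h e)) ` {F. F \<subseteq> ?P \<and> finite F})"
        by (rule bdd_aboveI2[of _ _ "(2 * zeta_real \<beta>) ^ card v * C"]) (use fin in simp)
    qed (rule G_nonneg)
    then show ?thesis using fin by (rule infsum_le_finite_sums)
  qed
  also have "\<dots> = real (card Z) * (2 * (2 * zeta_real \<beta>) ^ card ?u / real M)"
    using assms(2,3) by (simp add: C_def)
  finally show ?thesis .
qed

section \<open>The worst-case error\<close>

abbreviation cube_measure :: "nat \<Rightarrow> (nat \<Rightarrow> real) measure" where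
  "cube_measure d \<equiv> Pi\<^sub>M {1..d} (\<lambda>_. lborel)"

lemma unit_cube_sets: "unit_cube d \<in> sets (cube_measure d)"
  unfolding unit_cube_def by (intro sets_PiM_I_finite) auto

lemma emeasure_unit_cube: "emeasure (cube_measure d) (unit_cube d) = 1"
proof -
  interpret product_sigma_finite "\<lambda>_::nat. lborel :: real measure" by standard
  show ?thesis unfolding unit_cube_def by (subst emeasure_PiM) auto
qed

lemma measure_unit_cube: "measure (cube_measure d) (unit_cube d) = 1"
  by (simp add: measure_def emeasure_unit_cube)

lemma unit_cube_borel: "unit_cube d \<in> sets borel"
proof -
  have "unit_cube d = {x. \<forall>j. (j \<in> {1..d} \<longrightarrow> 0 \<le> x j \<and> x j \<le> 1) \<and> (j \<notin> {1..d} \<longrightarrow> x j = undefined)}"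
    unfolding unit_cube_def PiE_def extensional_def by auto
  moreover have "closed \<dots>"
    by (intro closed_Collect_all closed_Collect_conj closed_Collect_imp closed_Collect_le
        closed_Collect_eq open_Collect_const continuous_on_const continuous_on_product_coordinates)
  ultimately show ?thesis by simp
qed

text \<open>Continuity refers to the product topology on all of
  \<open>nat \<Rightarrow> real\<close>, integration to the product sigma-algebra over
  \<open>{1..d}\<close>; the identity links them. On the space of the measure every other coordinate
  is constantly \<open>undefined\<close>.\<close>

lemma measurable_cube_borel: "(\<lambda>x. x) \<in> measurable (cube_measure d) borel"
proof -
  have "(\<lambda>x. x) \<in> measurable (cube_measure d) (Pi\<^sub>M UNIV (\<lambda>_::nat. borel :: real measure))"
  proof (rule measurable_PiM_single')
    fix j :: nat
    show "(\<lambda>x. x j) \<in> borel_measurable (cube_measure d)"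
    proof (cases "j \<in> {1..d}")
      case True
      then show ?thesis using measurable_component_singleton[of j "{1..d}" "\<lambda>_. lborel"] by simp
    next
      case False
      then have "x j = undefined" if "x \<in> space (cube_measure d)" for x
        using that by (auto simp: space_PiM PiE_def extensional_def)
      then show ?thesis by (subst measurable_cong[of _ _ "\<lambda>_. undefined"]) auto
    qed
  qed auto
  also have "measurable (cube_measure d) (Pi\<^sub>M UNIV (\<lambda>_::nat. borel :: real measure)) =
      measurable (cube_measure d) borel"
    by (rule measurable_cong_sets[OF refl sets_PiM_equal_borel])
  finally show ?thesis .
qed

lemma set_integrable_cube:
  fixes f :: "(nat \<Rightarrow> real) \<Rightarrow> complex"
  assumes "continuous_on (unit_cube d) f" "\<And>x. x \<in> unit_cube d \<Longrightarrow> cmod (f x) \<le> B"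
  shows "set_integrable (cube_measure d) (unit_cube d) f"
  unfolding set_integrable_def
proof (rule integrableI_bounded_set[of "unit_cube d" _ _ B])
  have "(\<lambda>x. indicator (unit_cube d) x *\<^sub>R f x) \<in> borel_measurable borel"
    by (rule borel_measurable_continuous_on_indicator[OF unit_cube_borel assms(1)])
  then show "(\<lambda>x. indicator (unit_cube d) x *\<^sub>R f x) \<in> borel_measurable (cube_measure d)"
    using measurable_compose[OF measurable_cube_borel] by blast
  show "unit_cube d \<in> sets (cube_measure d)" by (rule unit_cube_sets)
  show "emeasure (cube_measure d) (unit_cube d) < \<infinity>" by (simp add: emeasure_unit_cube)
  show "AE x\<in>unit_cube d in cube_measure d. norm (indicat_real (unit_cube d) x *\<^sub>R f x) \<le> B"
    using assms(2) by auto
qed auto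

lemma cube_integral_cong:
  "(\<And>x. x \<in> unit_cube d \<Longrightarrow> f x = g x) \<Longrightarrow> cube_integral d f = cube_integral d g"
  unfolding cube_integral_def by (intro set_lebesgue_integral_cong unit_cube_sets) auto

lemma cmod_cube_integral_le:
  assumes "continuous_on (unit_cube d) f" "\<And>x. x \<in> unit_cube d \<Longrightarrow> cmod (f x) \<le> B"
  shows "cmod (cube_integral d f) \<le> B"
proof -
  let ?X = "unit_cube d"
  have int: "set_integrable (cube_measure d) ?X (\<lambda>x. B)"
    unfolding set_integrable_def
    using emeasure_unit_cube[of d] unit_cube_sets[of d]
    by (intro integrable_scaleR_left integrable_real_indicator) auto
  have "cmod (cube_integral d f) \<le> (LINT x|cube_measure d. norm (indicat_real ?X x *\<^sub>R f x))"
    unfolding cube_integral_def set_lebesgue_integral_def by (rule integral_norm_bound)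
  also have "\<dots> \<le> (LINT x|cube_measure d. indicat_real ?X x *\<^sub>R B)"
    using set_integrable_cube[OF assms] int assms(2) unfolding set_integrable_def
    by (intro integral_mono integrable_norm) (auto simp: indicator_def)
  also have "\<dots> = B"
    using emeasure_unit_cube[of d] unit_cube_sets[of d] by (simp add: measure_unit_cube)
  finally show ?thesis .
qed

lemma cube_integral_add:
  assumes "set_integrable (cube_measure d) (unit_cube d) f" "set_integrable (cube_measure d) (unit_cube d) g"
  shows "cube_integral d (\<lambda>x. f x + g x) = cube_integral d f + cube_integral d g"
  unfolding cube_integral_def using assms by (rule set_integral_add(2))

lemma cube_integral_diff:
  assumes "set_integrable (cube_measure d) (unit_cube d) f" "set_integrable (cube_measure d) (unit_cube d) g"
  shows "cube_integral d (\<lambda>x. f x - g x) = cube_integral d f - cube_integral d g"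
  unfolding cube_integral_def using assms by (rule set_integral_diff(2))

lemma cube_integral_cmult: "cube_integral d (\<lambda>x. c * f x) = c * cube_integral d f"
  unfolding cube_integral_def by simp

lemma cube_integral_sum:
  assumes "finite A" "\<And>i. i \<in> A \<Longrightarrow> set_integrable (cube_measure d) (unit_cube d) (f i)"
  shows "cube_integral d (\<lambda>x. \<Sum>i\<in>A. f i x) = (\<Sum>i\<in>A. cube_integral d (f i))"
  using assms unfolding cube_integral_def set_lebesgue_integral_def set_integrable_def scaleR_sum_right
  by (intro Bochner_Integration.integral_sum)

lemma cube_integral_one: "cube_integral d (\<lambda>x. 1) = 1"
proof -
  have "cube_integral d (\<lambda>x. 1) = of_real (measure (cube_measure d) (unit_cube d))"
    unfolding cube_integral_def set_lebesgue_integral_def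
    using emeasure_unit_cube[of d] unit_cube_sets[of d]
    by (subst integral_scaleR_left) (auto simp: scaleR_conv_of_real)
  then show ?thesis by (simp add: measure_unit_cube)
qed

text \<open>On extensional functions the indicator of the cube is a product of coordinate
  indicators, so the whole integrand factorises.\<close>

lemma cube_integral_prod:
  fixes g :: "nat \<Rightarrow> real \<Rightarrow> complex"
  assumes "\<And>j. j \<in> {1..d} \<Longrightarrow> continuous_on {0..1} (g j)"
  shows "cube_integral d (\<lambda>x. \<Prod>j\<in>{1..d}. g j (x j)) =
    (\<Prod>j\<in>{1..d}. LINT t|lborel. indicator {0..1} t *\<^sub>R g j t)"
proof -
  interpret product_sigma_finite "\<lambda>_::nat. lborel :: real measure" by standard
  have "cube_integral d (\<lambda>x. \<Prod>j\<in>{1..d}. g j (x j)) =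
      (LINT x|cube_measure d. (\<Prod>j\<in>{1..d}. indicator {0..1} (x j) *\<^sub>R g j (x j)))"
    unfolding cube_integral_def set_lebesgue_integral_def
  proof (rule Bochner_Integration.integral_cong[OF refl])
    fix x assume "x \<in> space (cube_measure d)"
    then have x: "x \<in> extensional {1..d}" by (auto simp: space_PiM PiE_def)
    show "indicat_real (unit_cube d) x *\<^sub>R (\<Prod>j\<in>{1..d}. g j (x j)) =
        (\<Prod>j\<in>{1..d}. indicator {0..1} (x j) *\<^sub>R g j (x j))"
    proof (cases "x \<in> unit_cube d")
      case True
      then show ?thesis by (auto simp: unit_cube_def indicator_def intro!: prod.cong)
    next
      case False
      with x obtain j where "j \<in> {1..d}" "x j \<notin> {0..1}"
        unfolding unit_cube_def PiE_def Pi_def by blast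
      then have "(\<Prod>j\<in>{1..d}. indicat_real {0..1} (x j) *\<^sub>R g j (x j)) = 0"
        by (intro prod_zero bexI[of _ j]) auto
      with False show ?thesis by simp
    qed
  qed
  also have "\<dots> = (\<Prod>j\<in>{1..d}. LINT t|lborel. indicator {0..1} t *\<^sub>R g j t)"
    using assms by (intro product_integral_prod borel_integrable_compact[unfolded scaleR_conv_of_real]
        borel_integrable_compact) auto
  finally show ?thesis .
qed

section \<open>Orthogonality of characters and termwise integration\<close>

lemma integral_cis:
  "(LINT t|lborel. indicator {0..1} t *\<^sub>R cis (2 * pi * (of_int n * t))) = (if n = 0 then 1 else 0)"
proof (cases "n = 0")
  case True
  have "(LINT t|lborel. indicator {0..1::real} t *\<^sub>R (1::complex)) = 1"
    by (subst integral_scaleR_left) auto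
  with True show ?thesis by simp
next
  case False
  define c where "c = 2 * pi * \<i> * of_int n"
  have c: "c \<noteq> 0" using False by (simp add: c_def)
  have cis: "cis (2 * pi * (of_int n * t)) = exp (c * of_real t)" for t
    by (simp add: cis_conv_exp c_def mult_ac)
  have "(LINT t|lborel. indicator {0..1} t *\<^sub>R exp (c * of_real t)) =
      exp (c * of_real 1) / c - exp (c * of_real 0) / c"
  proof (rule integral_FTC_atLeastAtMost)
    fix t :: real
    show "((\<lambda>t. exp (c * of_real t) / c) has_vector_derivative exp (c * of_real t)) (at t within {0..1})"
      using c by (intro has_vector_derivative_real_field) (auto intro!: derivative_eq_intros)
  qed (auto intro!: continuous_intros)
  also have "exp (c * of_real 1) = 1"
    unfolding c_def using exp_integer_2pi[of "of_int n"] by (simp add: mult_ac)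
  finally show ?thesis using False by (simp add: cis)
qed

lemma prod_cis: "finite A \<Longrightarrow> (\<Prod>j\<in>A. cis (f j)) = cis (\<Sum>j\<in>A. f j)"
  by (induction A rule: finite_induct) (auto simp: cis_mult)

text \<open>Filling up with zeros outside the support yields an integer vector whose nonzero set is
  that support. Distinct pairs thus differ in some coordinate, where the one-dimensional integral
  vanishes.\<close>

lemma cube_integral_character_orthogonal:
  assumes "i \<in> frequencies d" "k \<in> frequencies d"
  shows "cube_integral d (\<lambda>x. character i x * cnj (character k x)) = (if i = k then 1 else 0)"
proof -
  define ext where "ext q j = (if j \<in> fst q then snd q j else 0)"
    for q :: "nat set \<times> (nat \<Rightarrow> int)" and j
  have inj: "i = k" if eq: "\<And>j. j \<in> {1..d} \<Longrightarrow> ext i j = ext k j"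
  proof -
    obtain u h v l where [simp]: "i = (u, h)" "k = (v, l)" by (metis surj_pair)
    have u: "u \<subseteq> {1..d}" "h \<in> u \<rightarrow>\<^sub>E (UNIV - {0})" and v: "v \<subseteq> {1..d}" "l \<in> v \<rightarrow>\<^sub>E (UNIV - {0})"
      using assms by (auto simp: frequencies_def)
    have eq': "ext i j = ext k j" for j
      using eq[of j] u(1) v(1) by (cases "j \<in> {1..d}") (auto simp: ext_def)
    have "u = {j. ext i j \<noteq> 0}" "v = {j. ext k j \<noteq> 0}"
      using u(2) v(2) by (auto simp: ext_def dest: PiE_mem)
    then have "u = v" using eq' by simp
    moreover from this have "h j = l j" for j
      using eq'[of j] PiE_arb[OF u(2)] PiE_arb[OF v(2)]
      by (cases "j \<in> u") (auto simp: ext_def)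
    ultimately show "i = k" by auto
  qed
  have arg: "(\<Sum>j\<in>fst q. of_int (snd q j) * x j) = (\<Sum>j\<in>{1..d}. of_int (ext q j) * x j)"
    if "q \<in> frequencies d" for q and x :: "nat \<Rightarrow> real"
    using that by (intro sum.mono_neutral_cong_left) (auto simp: frequencies_def ext_def)
  have "character i x * cnj (character k x) =
      (\<Prod>j\<in>{1..d}. cis (2 * pi * (of_int (ext i j - ext k j) * x j)))" for x
    unfolding character_def arg[OF assms(1)] arg[OF assms(2)]
    by (simp add: prod_cis cis_cnj cis_mult sum_subtractf left_diff_distrib right_diff_distrib sum_distrib_left)
  then have "cube_integral d (\<lambda>x. character i x * cnj (character k x)) =
      (\<Prod>j\<in>{1..d}. LINT t|lborel. indicator {0..1} t *\<^sub>R cis (2 * pi * (of_int (ext i j - ext k j) * t)))"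
    by (simp only:) (intro cube_integral_prod continuous_intros)
  also have "\<dots> = (\<Prod>j\<in>{1..d}. if ext i j = ext k j then 1 else 0)"
    unfolding integral_cis by simp
  also have "\<dots> = (if i = k then 1 else 0)"
  proof (cases "\<forall>j\<in>{1..d}. ext i j = ext k j")
    case True
    then show ?thesis using inj by simp
  next
    case False
    then have "i \<noteq> k" by auto
    with False show ?thesis by auto
  qed
  finally show ?thesis .
qed

lemma frequencies_zero: "({}, \<lambda>_. undefined) \<in> frequencies d"
  by (simp add: frequencies_def)

lemma character_zero: "character ({}, h) x = 1"
  by (simp add: character_def)

lemma cube_integral_character:
  assumes "i \<in> frequencies d"
  shows "cube_integral d (character i) = (if i = ({}, \<lambda>_. undefined) then 1 else 0)"
  using cube_integral_character_orthogonal[OF assms frequencies_zero]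
  by (simp add: character_zero)

lemma continuous_on_character: "continuous_on A (character i)"
  unfolding character_def
  by (intro continuous_intros continuous_on_subset[OF continuous_on_product_coordinates subset_UNIV])

lemma continuous_on_infsum:
  fixes e :: "'i \<Rightarrow> (nat \<Rightarrow> real) \<Rightarrow> complex"
  assumes "(\<lambda>i. cmod (a i)) summable_on I"
    and "\<And>i. i \<in> I \<Longrightarrow> continuous_on X (e i)"
    and "\<And>i x. i \<in> I \<Longrightarrow> x \<in> X \<Longrightarrow> cmod (e i x) \<le> 1"
  shows "continuous_on X (\<lambda>x. \<Sum>\<^sub>\<infinity>i\<in>I. a i * e i x)"
proof (rule uniform_limit_theorem)
  show "uniform_limit X (\<lambda>F x. \<Sum>i\<in>F. a i * e i x) (\<lambda>x. \<Sum>\<^sub>\<infinity>i\<in>I. a i * e i x) (finite_subsets_at_top I)"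
    using assms by (intro Weierstrass_m_test_general[of _ _ _ "\<lambda>i. cmod (a i)"])
      (auto simp: norm_mult mult_left_le)
  show "\<forall>\<^sub>F F in finite_subsets_at_top I. continuous_on X (\<lambda>x. \<Sum>i\<in>F. a i * e i x)"
    using assms by (intro eventually_finite_subsets_at_top_weakI continuous_intros) auto
qed simp

text \<open>Unconditional sums converge along the filter of finite sets rather than along a
  sequence. Termwise integration therefore rests on uniform convergence over a set of measure
  1.\<close>

lemma cube_integral_infsum:
  assumes a: "(\<lambda>i. cmod (a i)) summable_on I"
    and cont: "\<And>i. i \<in> I \<Longrightarrow> continuous_on (unit_cube d) (e i)"
    and bound: "\<And>i x. i \<in> I \<Longrightarrow> x \<in> unit_cube d \<Longrightarrow> cmod (e i x) \<le> 1"
  shows "((\<lambda>i. a i * cube_integral d (e i)) has_sum cube_integral d (\<lambda>x. \<Sum>\<^sub>\<infinity>i\<in>I. a i * e i x)) I"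
  unfolding has_sum_def
proof (rule tendstoI)
  let ?X = "unit_cube d"
  let ?f = "\<lambda>x. \<Sum>\<^sub>\<infinity>i\<in>I. a i * e i x" and ?p = "\<lambda>F x. \<Sum>i\<in>F. a i * e i x"
  have f: "continuous_on ?X ?f" by (rule continuous_on_infsum[OF assms])
  have f_le: "cmod (?f x) \<le> (\<Sum>\<^sub>\<infinity>i\<in>I. cmod (a i))" if "x \<in> ?X" for x
  proof (rule norm_infsum_le[OF has_sum_infsum has_sum_infsum[OF a]])
    show "(\<lambda>i. a i * e i x) summable_on I"
      by (rule abs_summable_summable[OF Infinite_Sum.abs_summable_on_comparison_test'[OF a]])
        (use bound that in \<open>auto simp: norm_mult mult_left_le\<close>)
  qed (use bound that in \<open>auto simp: norm_mult mult_left_le\<close>)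
  fix r :: real assume "r > 0"
  have "uniform_limit ?X ?p ?f (finite_subsets_at_top I)"
    using assms by (intro Weierstrass_m_test_general[of _ _ _ "\<lambda>i. cmod (a i)"])
      (auto simp: norm_mult mult_left_le)
  then have "\<forall>\<^sub>F F in finite_subsets_at_top I. \<forall>x\<in>?X. dist (?p F x) (?f x) < r / 2"
    using \<open>r > 0\<close> by (intro uniform_limitD) auto
  then show "\<forall>\<^sub>F F in finite_subsets_at_top I.
      dist (\<Sum>i\<in>F. a i * cube_integral d (e i)) (cube_integral d ?f) < r"
  proof (rule eventually_mp[rotated], intro eventually_finite_subsets_at_top_weakI impI)
    fix F assume F: "finite F" "F \<subseteq> I" and close: "\<forall>x\<in>?X. dist (?p F x) (?f x) < r / 2"
    have int: "set_integrable (cube_measure d) ?X (\<lambda>x. a i * e i x)" if "i \<in> F" for i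
      using that F cont bound by (intro set_integrable_cube[of _ _ "cmod (a i)"] continuous_intros)
        (auto simp: norm_mult mult_left_le)
    have "(\<Sum>i\<in>F. a i * cube_integral d (e i)) = cube_integral d (?p F)"
      using F int by (simp add: cube_integral_sum cube_integral_cmult)
    also have "\<dots> - cube_integral d ?f = cube_integral d (\<lambda>x. ?p F x - ?f x)"
    proof (rule cube_integral_diff[symmetric])
      show "set_integrable (cube_measure d) ?X (?p F)"
        unfolding set_integrable_def scaleR_sum_right
        using int unfolding set_integrable_def by (intro Bochner_Integration.integrable_sum) auto
      show "set_integrable (cube_measure d) ?X ?f"
        by (rule set_integrable_cube[OF f f_le])
    qed
    finally have "dist (\<Sum>i\<in>F. a i * cube_integral d (e i)) (cube_integral d ?f) =
        cmod (cube_integral d (\<lambda>x. ?p F x - ?f x))"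
      by (simp add: dist_norm)
    also have "\<dots> \<le> r / 2"
      using F cont close by (intro cmod_cube_integral_le continuous_intros f)
        (auto simp: dist_norm intro: less_imp_le)
    finally show "dist (\<Sum>i\<in>F. a i * cube_integral d (e i)) (cube_integral d ?f) < r"
      using \<open>r > 0\<close> by simp
  qed
qed

section \<open>Characters at lattice points\<close>

lemma cis_shift_int: "cis (2 * pi * (t - of_int n)) = cis (2 * pi * t)"
proof -
  have "cis (2 * pi * t) = cis (2 * pi * (t - of_int n)) * cis (2 * pi * of_int n)"
    by (simp add: cis_mult algebra_simps)
  then show ?thesis by (simp add: cis_multiple_2pi)
qed

lemma cis_2pi_eq_1_iff: "cis (2 * pi * t) = 1 \<longleftrightarrow> t \<in> \<int>"
  unfolding cis_conv_exp exp_eq_1 by (auto simp: Ints_def)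

lemma sum_roots_of_unity:
  fixes a :: int
  assumes "N > 0"
  shows "(\<Sum>k<N. cis (2 * pi * (real k / real N * of_int a))) = (if int N dvd a then of_nat N else 0)"
proof -
  define \<omega> where "\<omega> = cis (2 * pi * (of_int a / real N))"
  have pow: "cis (2 * pi * (real k / real N * of_int a)) = \<omega> ^ k" for k
    by (simp add: \<omega>_def Complex.DeMoivre mult_ac)
  have "of_int a / real N \<in> \<int> \<longleftrightarrow> int N dvd a"
  proof
    assume "of_int a / real N \<in> \<int>"
    then obtain q where "of_int a / real N = of_int q" by (auto simp: Ints_def)
    then have "real_of_int a = of_int (int N * q)" using assms by (simp add: field_simps)
    then have "a = int N * q" by linarith
    then show "int N dvd a" by simp
  next
    assume "int N dvd a"
    then show "of_int a / real N \<in> \<int>" using assms by (auto simp: dvd_def)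
  qed
  then have \<omega>: "\<omega> = 1 \<longleftrightarrow> int N dvd a" unfolding \<omega>_def cis_2pi_eq_1_iff .
  have "\<omega> ^ N = cis (2 * pi * of_int a)" using assms by (simp add: \<omega>_def Complex.DeMoivre)
  then have "\<omega> ^ N = 1" using cis_2pi_eq_1_iff[of "of_int a"] by simp
  then show ?thesis unfolding pow using \<omega> by (auto simp: sum_gp_strict)
qed

lemma lattice_point_mem: "lattice_point N d z k \<in> unit_cube d"
  by (auto simp: lattice_point_def unit_cube_def frac_ge_0 less_imp_le[OF frac_lt_1])

text \<open>Taking fractional parts shifts each coordinate by an integer, which characters with
  integer frequencies do not see.\<close>

lemma character_lattice_point:
  assumes "i \<in> frequencies d"
  shows "character i (lattice_point N d z k) =
    cis (2 * pi * (real k / real N * of_int (\<Sum>j\<in>fst i. snd i j * z j)))"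
proof -
  let ?u = "fst i" and ?h = "snd i"
  have u: "?u \<subseteq> {1..d}" using assms by (auto simp: frequencies_def)
  have "(\<Sum>j\<in>?u. of_int (?h j) * lattice_point N d z k j) =
      (\<Sum>j\<in>?u. of_int (?h j) * (real k / real N * of_int (z j) - of_int \<lfloor>real k / real N * of_int (z j)\<rfloor>))"
    using u by (intro sum.cong) (auto simp: lattice_point_def frac_def)
  also have "\<dots> = real k / real N * of_int (\<Sum>j\<in>?u. ?h j * z j) -
      of_int (\<Sum>j\<in>?u. ?h j * \<lfloor>real k / real N * of_int (z j)\<rfloor>)"
    by (simp add: sum_subtractf right_diff_distrib sum_distrib_left mult_ac)
  finally show ?thesis by (simp only: character_def cis_shift_int)
qed

lemma sum_character_lattice_point:
  assumes "i \<in> frequencies d" "N > 0"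
  shows "(\<Sum>k<N. character i (lattice_point N d z k)) =
    (if int N dvd (\<Sum>j\<in>fst i. snd i j * z j) then of_nat N else 0)"
  unfolding character_lattice_point[OF assms(1)] by (rule sum_roots_of_unity[OF assms(2)])

section \<open>The Korobov space and its error functional\<close>

context korobov
begin

lemma korobov_kernel_commute: "cnj (korobov_kernel d \<alpha> \<gamma> x y) = korobov_kernel d \<alpha> \<gamma> y x"
  unfolding korobov_kernel_eq infsum_cnj[symmetric] by (simp add: mult.commute)

lemma korobov_kernel_diag:
  "korobov_kernel d \<alpha> \<gamma> x x = of_real (infsum (korobov_weight \<alpha> \<gamma>) (frequencies d))"
  unfolding korobov_kernel_eq infsum_complex_of_real[symmetric]
  by (intro infsum_cong) (simp add: complex_norm_square[symmetric])

lemma infsum_weight_nonneg: "infsum (korobov_weight \<alpha> \<gamma>) (frequencies d) \<ge> 0"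
  by (intro infsum_nonneg less_imp_le korobov_weight_pos)

text \<open>The features are the characters scaled by the square roots of the weights. Injectivity
  is uniqueness of Fourier coefficients: integrating the series against the conjugate of the
  \<open>k\<close>-th character isolates the \<open>k\<close>-th coefficient.\<close>

lemma ex_rkhs: "\<exists>H ip. rkhs (unit_cube d) (korobov_kernel d \<alpha> \<gamma>) H ip"
proof (rule rkhs_of_feature_map)
  let ?I = "frequencies d" and ?X = "unit_cube d"
  let ?r = "korobov_weight \<alpha> \<gamma>"
  let ?\<phi> = "\<lambda>i x. of_real (sqrt (?r i)) * character i x"
  have r: "?r i \<ge> 0" if "i \<in> ?I" for i using korobov_weight_pos[OF that] by simp
  show sq: "(\<lambda>i. (cmod (?\<phi> i x))\<^sup>2) summable_on ?I" for x
    using korobov_weight_summable r by (simp add: norm_mult cong: summable_on_cong)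
  show "korobov_kernel d \<alpha> \<gamma> x y = (\<Sum>\<^sub>\<infinity>i\<in>?I. ?\<phi> i x * cnj (?\<phi> i y))" for x y
    unfolding korobov_kernel_eq
  proof (rule infsum_cong)
    fix i assume "i \<in> ?I"
    then have "complex_of_real (?r i) = of_real (sqrt (?r i)) * of_real (sqrt (?r i))"
      using r unfolding of_real_mult[symmetric] by simp
    then show "of_real (?r i) * (character i x * cnj (character i y)) = ?\<phi> i x * cnj (?\<phi> i y)"
      by (simp add: mult_ac)
  qed
  fix c assume c: "c \<in> ell2 ?I" and zero: "\<And>x. x \<in> ?X \<Longrightarrow> (\<Sum>\<^sub>\<infinity>i\<in>?I. c i * ?\<phi> i x) = 0"
  \<comment> \<open>The \<open>c i\<close> are merely square-summable; multiplied by the square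
    roots of the summable weights they become absolutely summable, as termwise integration
    demands.\<close>
  define a where "a i = c i * of_real (sqrt (?r i))" for i
  have a: "(\<lambda>i. cmod (a i)) summable_on ?I"
    unfolding a_def by (rule cauchy_schwarz_summable[OF ell2_summable[OF c]])
      (use korobov_weight_summable r in \<open>simp cong: summable_on_cong\<close>)
  show "c = (\<lambda>_. 0)"
  proof
    fix k show "c k = 0"
    proof (cases "k \<in> ?I")
      case True
      let ?e = "\<lambda>i x. character i x * cnj (character k x)"
      have "((\<lambda>i. a i * cube_integral d (?e i)) has_sum
          cube_integral d (\<lambda>x. \<Sum>\<^sub>\<infinity>i\<in>?I. a i * ?e i x)) ?I"
        by (intro cube_integral_infsum a continuous_intros continuous_on_character) (simp add: norm_mult)
      \<comment> \<open>Zero is written as \<open>0 * 0\<close> so that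
        \<open>cube_integral_cmult\<close> evaluates the integral.\<close>
      also have "cube_integral d (\<lambda>x. \<Sum>\<^sub>\<infinity>i\<in>?I. a i * ?e i x) = cube_integral d (\<lambda>x. 0 * 0)"
      proof (rule cube_integral_cong)
        fix x assume "x \<in> ?X"
        have "(\<Sum>\<^sub>\<infinity>i\<in>?I. a i * ?e i x) = (\<Sum>\<^sub>\<infinity>i\<in>?I. c i * ?\<phi> i x) * cnj (character k x)"
          unfolding infsum_cmult_left'[symmetric] by (simp add: a_def mult_ac)
        then show "(\<Sum>\<^sub>\<infinity>i\<in>?I. a i * ?e i x) = 0 * 0" using zero[OF \<open>x \<in> ?X\<close>] by simp
      qed
      also have "\<dots> = 0" unfolding cube_integral_cmult by simp
      finally have "(\<Sum>\<^sub>\<infinity>i\<in>?I. a i * cube_integral d (?e i)) = 0" by (rule infsumI)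
      also have "(\<Sum>\<^sub>\<infinity>i\<in>?I. a i * cube_integral d (?e i)) = (\<Sum>\<^sub>\<infinity>i\<in>{k}. a i)"
        using True by (intro infsum_cong_neutral) (auto simp: cube_integral_character_orthogonal)
      finally show "c k = 0" using korobov_weight_pos[OF True] by (simp add: a_def)
    qed (rule ell2_outside[OF c])
  qed
qed

text \<open>Existence of some space makes the chosen one satisfy the axioms, and the error is
  computed from these axioms alone.\<close>

lemma korobov_space_rkhs:
  obtains H ip where "korobov_space d \<alpha> \<gamma> = (H, ip)"
    "rkhs (unit_cube d) (korobov_kernel d \<alpha> \<gamma>) H ip"
proof -
  have "\<exists>p. case p of (H, ip) \<Rightarrow> rkhs (unit_cube d) (korobov_kernel d \<alpha> \<gamma>) H ip"
    using ex_rkhs by auto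
  then have "case korobov_space d \<alpha> \<gamma> of (H, ip) \<Rightarrow> rkhs (unit_cube d) (korobov_kernel d \<alpha> \<gamma>) H ip"
    unfolding korobov_space_def by (rule someI_ex)
  with that show ?thesis by (cases "korobov_space d \<alpha> \<gamma>") auto
qed

lemma continuous_on_korobov_kernel: "continuous_on A (\<lambda>x. korobov_kernel d \<alpha> \<gamma> x y)"
  unfolding korobov_kernel_eq
proof (rule continuous_on_infsum)
  show "(\<lambda>i. cmod (complex_of_real (korobov_weight \<alpha> \<gamma> i))) summable_on frequencies d"
    using weighted_summable[of "\<lambda>_. 1"] by simp
qed (auto intro!: continuous_intros continuous_on_character simp: norm_mult)

lemma cube_integral_korobov_kernel: "cube_integral d (\<lambda>x. korobov_kernel d \<alpha> \<gamma> x y) = 1"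
proof -
  let ?I = "frequencies d" and ?a = "\<lambda>i. of_real (korobov_weight \<alpha> \<gamma> i) * cnj (character i y)"
  have "((\<lambda>i. ?a i * cube_integral d (character i)) has_sum
      cube_integral d (\<lambda>x. \<Sum>\<^sub>\<infinity>i\<in>?I. ?a i * character i x)) ?I"
    by (intro cube_integral_infsum weighted_summable continuous_on_character) auto
  moreover have "(\<lambda>x. \<Sum>\<^sub>\<infinity>i\<in>?I. ?a i * character i x) = (\<lambda>x. korobov_kernel d \<alpha> \<gamma> x y)"
    by (simp add: korobov_kernel_eq mult_ac)
  ultimately have "cube_integral d (\<lambda>x. korobov_kernel d \<alpha> \<gamma> x y) =
      (\<Sum>\<^sub>\<infinity>i\<in>?I. ?a i * cube_integral d (character i))" by (simp add: infsumI)
  also have "\<dots> = (\<Sum>\<^sub>\<infinity>i\<in>{({}, \<lambda>_. undefined)}. ?a i)"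
    by (intro infsum_cong_neutral) (auto simp: cube_integral_character frequencies_zero)
  also have "\<dots> = 1" by (simp add: korobov_weight_def character_zero)
  finally show ?thesis .
qed

text \<open>A frequency contributes its weight times the squared modulus of its character sum over
  the lattice, which is the square of \<open>N\<close> on the dual lattice and 0 elsewhere. The zero
  frequency gives the 1.\<close>

lemma double_sum_korobov_kernel:
  fixes z :: "nat \<Rightarrow> int"
  assumes "N > 0"
  defines "p \<equiv> lattice_point N d z"
  shows "(\<Sum>l<N. \<Sum>k<N. korobov_kernel d \<alpha> \<gamma> (p l) (p k)) / (of_nat N)\<^sup>2 =
    of_real (1 + (\<Sum>u\<in>Pow {1..d} - {{}}. \<gamma> u * dual_sum \<alpha> N u z))"
proof -
  let ?I = "frequencies d" and ?r = "korobov_weight \<alpha> \<gamma>"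
  let ?D = "\<lambda>i. int N dvd (\<Sum>j\<in>fst i. snd i j * z j)"
  let ?t = "\<lambda>l k i. of_real (?r i) * (character i (p l) * cnj (character i (p k)))"
  have t: "?t l k summable_on ?I" for l k
    by (rule abs_summable_summable[OF weighted_summable]) (simp add: norm_mult)
  have "(\<Sum>l<N. \<Sum>k<N. korobov_kernel d \<alpha> \<gamma> (p l) (p k)) =
      (\<Sum>x\<in>{..<N} \<times> {..<N}. infsum (?t (fst x) (snd x)) ?I)"
    by (simp add: korobov_kernel_eq sum.cartesian_product case_prod_beta)
  also have "\<dots> = (\<Sum>\<^sub>\<infinity>i\<in>?I. \<Sum>x\<in>{..<N} \<times> {..<N}. ?t (fst x) (snd x) i)"
    by (intro infsum_finite_sum t) auto
  also have "\<dots> = (\<Sum>\<^sub>\<infinity>i\<in>?I. of_real (if ?D i then ?r i else 0) * (of_nat N)\<^sup>2)"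
  proof (rule infsum_cong)
    fix i assume i: "i \<in> ?I"
    have "(\<Sum>x\<in>{..<N} \<times> {..<N}. ?t (fst x) (snd x) i) =
        of_real (?r i) * ((\<Sum>l<N. character i (p l)) * cnj (\<Sum>k<N. character i (p k)))"
      by (simp only: cnj_sum sum_product)
        (simp only: sum.cartesian_product case_prod_beta sum_distrib_left)
    also have "\<dots> = of_real (if ?D i then ?r i else 0) * (of_nat N)\<^sup>2"
      unfolding p_def sum_character_lattice_point[OF i assms(1)] by (simp add: power2_eq_square)
    finally show "(\<Sum>x\<in>{..<N} \<times> {..<N}. ?t (fst x) (snd x) i) =
        of_real (if ?D i then ?r i else 0) * (of_nat N)\<^sup>2" .
  qed
  also have "\<dots> = of_real (\<Sum>\<^sub>\<infinity>i\<in>?I. if ?D i then ?r i else 0) * (of_nat N)\<^sup>2"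
    by (simp add: infsum_cmult_left' infsum_complex_of_real)
  finally have "(\<Sum>l<N. \<Sum>k<N. korobov_kernel d \<alpha> \<gamma> (p l) (p k)) / (of_nat N)\<^sup>2 =
      of_real (\<Sum>\<^sub>\<infinity>i\<in>?I. if ?D i then ?r i else 0)"
    using assms(1) by simp
  also have "(\<Sum>\<^sub>\<infinity>i\<in>?I. if ?D i then ?r i else 0) =
      (if ?D ({}, \<lambda>_. undefined) then ?r ({}, \<lambda>_. undefined) else 0) +
      (\<Sum>u\<in>Pow {1..d} - {{}}. \<Sum>\<^sub>\<infinity>h\<in>u \<rightarrow>\<^sub>E (UNIV - {0}). if ?D (u, h) then ?r (u, h) else 0)"
  proof (rule infsum_frequencies)
    show "(\<lambda>i. if ?D i then ?r i else 0) summable_on ?I"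
      using korobov_weight_summable
      by (rule summable_on_comparison_test) (auto simp: less_imp_le[OF korobov_weight_pos])
  qed
  also have "(if ?D ({}, \<lambda>_. undefined) then ?r ({}, \<lambda>_. undefined) else 0) = 1"
    by (simp add: korobov_weight_def)
  also have "(\<Sum>u\<in>Pow {1..d} - {{}}. \<Sum>\<^sub>\<infinity>h\<in>u \<rightarrow>\<^sub>E (UNIV - {0}). if ?D (u, h) then ?r (u, h) else 0) =
      (\<Sum>u\<in>Pow {1..d} - {{}}. \<gamma> u * dual_sum \<alpha> N u z)"
    unfolding dual_sum_def infsum_cmult_right'[symmetric]
    by (intro sum.cong refl infsum_cong_neutral) (auto simp: korobov_weight_def)
  finally show ?thesis .
qed

text \<open>The representer \<xi> of the error functional is 1 minus the lattice average of kernel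
  sections. Its integral is 0, so its squared norm is minus its lattice average, that is, the double
  average of the kernel minus 1.\<close>

theorem worst_case_error_sq:
  assumes "N > 0"
  shows "(worst_case_error N d \<alpha> \<gamma> z)\<^sup>2 =
    (\<Sum>u\<in>Pow {1..d} - {{}}. \<gamma> u * dual_sum \<alpha> N u z)" (is "_ = ?E")
proof -
  let ?X = "unit_cube d" and ?K = "korobov_kernel d \<alpha> \<gamma>"
  obtain H ip where space: "korobov_space d \<alpha> \<gamma> = (H, ip)" and "rkhs ?X ?K H ip"
    by (rule korobov_space_rkhs)
  then interpret rkhs ?X ?K H ip by simp
  define R where "R = infsum (korobov_weight \<alpha> \<gamma>) (frequencies d)"
  have R: "R \<ge> 0" unfolding R_def by (rule infsum_weight_nonneg)
  have diag: "?K x x = of_real R" for x unfolding R_def by (rule korobov_kernel_diag)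
  \<comment> \<open>Elements of the chosen space are known only through the reproducing property;
    continuity is read off from the kernel.\<close>
  have cont: "continuous_on ?X f" if f: "f \<in> H" for f
    unfolding continuous_on_def
  proof
    fix x assume x: "x \<in> ?X"
    have "((\<lambda>y. ?K y x) \<longlongrightarrow> ?K x x) (at x within ?X)"
      using continuous_on_korobov_kernel[of ?X x] x by (simp add: continuous_on_def)
    then have lim: "((\<lambda>y. sqrt (sqnorm f) * sqrt (Re (?K x x) - 2 * Re (?K y x) + R)) \<longlongrightarrow>
        sqrt (sqnorm f) * sqrt (Re (?K x x) - 2 * Re (?K x x) + R)) (at x within ?X)"
      by (intro tendsto_intros)
    show "(f \<longlongrightarrow> f x) (at x within ?X)"
    proof (rule Lim_null[THEN iffD2], rule Lim_null_comparison)
      show "\<forall>\<^sub>F y in at x within ?X. norm (f y - f x) \<le>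
          sqrt (sqnorm f) * sqrt (Re (?K x x) - 2 * Re (?K y x) + R)"
      proof -
        have "norm (f y - f x) \<le> sqrt (sqnorm f) * sqrt (Re (?K x x) - 2 * Re (?K y x) + R)"
          if "y \<in> ?X" for y
          using cmod_eval_diff_le[OF f x that] by (simp add: norm_minus_commute diag[of y])
        then show ?thesis by (simp add: eventually_at_filter)
      qed
      show "((\<lambda>y. sqrt (sqnorm f) * sqrt (Re (?K x x) - 2 * Re (?K y x) + R)) \<longlongrightarrow> 0) (at x within ?X)"
        using lim by (simp add: diag[of x])
    qed
  qed
  have bound: "cmod (f x) \<le> sqrt R * sqrt (sqnorm f)" if "f \<in> H" "x \<in> ?X" for f x
    using cmod_eval_le[OF that] by (simp add: diag mult.commute)
  have int: "set_integrable (cube_measure d) ?X f" if "f \<in> H" for f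
    using cont[OF that] bound[OF that] by (rule set_integrable_cube)
  define p where "p = lattice_point N d z"
  have p: "p k \<in> ?X" for k unfolding p_def by (rule lattice_point_mem)
  define L where "L f = cube_integral d f - lattice_rule N d z f" for f
  have Q_le: "cmod (lattice_rule N d z f) \<le> sqrt R * sqrt (sqnorm f)" if "f \<in> H" for f
  proof -
    have "cmod (\<Sum>k<N. f (p k)) \<le> (\<Sum>k<N. sqrt R * sqrt (sqnorm f))"
      by (intro sum_norm_le bound that p)
    then show ?thesis using assms by (simp add: lattice_rule_def p_def norm_divide field_simps)
  qed
  \<comment> \<open>One \<open>sqrt R\<close> bounds the integral and one the lattice average; any
    finite constant would do for the Riesz theorem.\<close>
  have L: "bounded_functional L (2 * sqrt R)"
    unfolding bounded_functional_def
  proof (intro conjI ballI allI)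
    show "L (\<lambda>x. f x + g x) = L f + L g" if "f \<in> H" "g \<in> H" for f g
      using that by (simp add: L_def cube_integral_add int lattice_rule_def sum.distrib add_divide_distrib)
    show "L (\<lambda>x. c * f x) = c * L f" for f c
      by (simp add: L_def cube_integral_cmult lattice_rule_def sum_distrib_left[symmetric] right_diff_distrib)
    show "cmod (L f) \<le> 2 * sqrt R * sqrt (sqnorm f)" if "f \<in> H" for f
      using norm_triangle_ineq4[of "cube_integral d f" "lattice_rule N d z f"] Q_le[OF that]
        cmod_cube_integral_le[OF cont[OF that] bound[OF that]] unfolding L_def by simp
  qed
  have int_kern: "cube_integral d (kern y) = 1" for y
    using cube_integral_korobov_kernel[of y] cube_integral_cong[of d "kern y" "\<lambda>x. ?K x y"]
    by (simp add: kern_def)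
  define \<xi> where "\<xi> x = (if x \<in> ?X then cnj (L (kern x)) else 0)" for x
  \<comment> \<open>Hermitian symmetry turns the conjugate of \<open>kern x (p k)\<close> into
    \<open>kern (p k) x\<close>.\<close>
  have \<xi>: "\<xi> x = 1 - 1 / of_nat N * (\<Sum>k<N. kern (p k) x)" if "x \<in> ?X" for x
    using that p unfolding \<xi>_def L_def int_kern lattice_rule_def p_def[symmetric]
    by (simp add: kern_def korobov_kernel_commute)
  have "cube_integral d \<xi> = cube_integral d (\<lambda>x. 1 - 1 / of_nat N * (\<Sum>k<N. kern (p k) x))"
    by (rule cube_integral_cong) (rule \<xi>)
  also have "\<dots> = 1 - 1 / of_nat N * (\<Sum>k<N. cube_integral d (kern (p k)))"
  proof -
    have "set_integrable (cube_measure d) ?X (\<lambda>x. 1 :: complex)"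
      by (rule set_integrable_cube[of _ _ 1]) auto
    moreover have "set_integrable (cube_measure d) ?X (\<lambda>x. 1 / of_nat N * (\<Sum>k<N. kern (p k) x))"
      by (intro int scale_mem sum_mem kern_mem p) auto
    ultimately show ?thesis
      by (simp add: cube_integral_diff cube_integral_cmult cube_integral_sum cube_integral_one
          int kern_mem p del: times_divide_eq_left)
  qed
  also have "\<dots> = 0" using assms by (simp add: int_kern)
  finally have int_\<xi>: "cube_integral d \<xi> = 0" .
  have "lattice_rule N d z \<xi> = (\<Sum>l<N. 1 - 1 / of_nat N * (\<Sum>k<N. ?K (p l) (p k))) / of_nat N"
    unfolding lattice_rule_def p_def[symmetric] using p by (simp add: \<xi> kern_def)
  also have "\<dots> = 1 - (\<Sum>l<N. \<Sum>k<N. ?K (p l) (p k)) / (of_nat N)\<^sup>2"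
    using assms by (simp add: sum_subtractf sum_divide_distrib[symmetric] diff_divide_distrib power2_eq_square)
  also have "\<dots> = - of_real ?E"
    unfolding p_def double_sum_korobov_kernel[OF assms] by simp
  finally have "Re (L \<xi>) = ?E" by (simp add: L_def int_\<xi>)
  moreover have "?E \<ge> 0"
    unfolding dual_sum_def by (intro sum_nonneg mult_nonneg_nonneg infsum_nonneg prod_nonneg ballI)
      (auto intro: less_imp_le[OF \<gamma>])
  moreover have "worst_case_error N d \<alpha> \<gamma> z = sqrt (Re (L \<xi>))"
    using SUP_unit_ball_functional(2)[OF L] R
    unfolding worst_case_error_def korobov_unit_ball_def space L_def[symmetric] \<xi>_def[abs_def] by simp
  ultimately show ?thesis by simp
qed

end

section \<open>The reduced component-by-component construction\<close>

lemma Pow_Suc_minus_empty: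
  fixes d :: nat
  shows "Pow {1..d + 1} - {{}} = (Pow {1..d} - {{}}) \<union> insert (d + 1) ` Pow {1..d}"
  (is "_ = ?R")
proof -
  have "{1..d + 1} = insert (d + 1) {1..d}" by auto
  then have "Pow {1..d + 1} - {{}} = (Pow {1..d} \<union> insert (d + 1) ` Pow {1..d}) - {{}}"
    by (simp only: Pow_insert)
  also have "\<dots> = ?R" by auto
  finally show ?thesis .
qed

lemma sum_Pow_Suc:
  fixes f :: "nat set \<Rightarrow> real"
  shows "(\<Sum>u\<in>Pow {1..d + 1} - {{}}. f u) =
    (\<Sum>u\<in>Pow {1..d} - {{}}. f u) + (\<Sum>v\<in>Pow {1..d}. f (insert (d + 1) v))"
proof -
  have "inj_on (insert (d + 1)) (Pow {1..d})"
    by (intro inj_onI) (metis Pow_iff atLeastAtMost_iff insert_ident not_add_less1 not_le lessI Suc_eq_plus1 subsetD)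
  then show ?thesis
    unfolding Pow_Suc_minus_empty by (subst sum.union_disjoint) (auto simp: sum.reindex)
qed

section \<open>Increments of the squared error and induction over the dimension\<close>

locale reduced_construction =
  fixes b m s :: nat and \<alpha> :: real and \<gamma> :: "nat set \<Rightarrow> real" and w :: "nat \<Rightarrow> nat" and z :: "nat \<Rightarrow> int"
  assumes prime_b: "prime b" and \<alpha>: "\<alpha> > 1"
    and \<gamma>: "\<And>u. u \<subseteq> {1..s} \<Longrightarrow> \<gamma> u > 0"
    and mono_w: "mono_on {1..s} w"
    and cbc: "reduced_cbc b m s \<alpha> \<gamma> w z"
begin

abbreviation "zv \<equiv> reduced_vector b w z"

definition sq_error :: "nat \<Rightarrow> real" where
  "sq_error d = (\<Sum>u\<in>Pow {1..d} - {{}}. \<gamma> u * dual_sum \<alpha> (b ^ m) u zv)"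

text \<open>Only supports containing \<open>d + 1\<close> depend on the candidate \<open>c\<close>,
  so minimising the error in step \<open>d + 1\<close> amounts to minimising this part.\<close>

definition increment :: "nat \<Rightarrow> int \<Rightarrow> real" where
  "increment d c = (\<Sum>v\<in>Pow {1..d}. \<gamma> (insert (d + 1) v) *
     dual_sum \<alpha> (b ^ m) (insert (d + 1) v) (zv(d + 1 := int (b ^ w (d + 1)) * c)))"

lemma N_pos: "b ^ m > 0"
  using prime_b prime_gt_0_nat by simp

lemma worst_case_error_eq: "d \<le> s \<Longrightarrow> (worst_case_error (b ^ m) d \<alpha> \<gamma> zv)\<^sup>2 = sq_error d"
proof -
  assume "d \<le> s"
  then have sub: "{1..d} \<subseteq> {1..s}" by auto
  interpret korobov d \<alpha> \<gamma>
    by unfold_locales (rule \<alpha>, rule \<gamma>[OF order_trans[OF _ sub]])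
  show ?thesis unfolding sq_error_def by (rule worst_case_error_sq[OF N_pos])
qed

lemma worst_case_error_upd_eq:
  assumes "d < s"
  shows "(worst_case_error (b ^ m) (d + 1) \<alpha> \<gamma> (reduced_vector b w (z(d + 1 := c))))\<^sup>2 = sq_error d + increment d c"
proof -
  have sub: "{1..d + 1} \<subseteq> {1..s}" using assms by auto
  interpret korobov "d + 1" \<alpha> \<gamma>
    by unfold_locales (rule \<alpha>, rule \<gamma>[OF order_trans[OF _ sub]])
  have upd: "reduced_vector b w (z(d + 1 := c)) = zv(d + 1 := int (b ^ w (d + 1)) * c)"
    by (auto simp: reduced_vector_def)
  have "(\<Sum>u\<in>Pow {1..d} - {{}}. \<gamma> u * dual_sum \<alpha> (b ^ m) u (zv(d + 1 := int (b ^ w (d + 1)) * c))) = sq_error d"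
    unfolding sq_error_def by (intro sum.cong refl arg_cong2[of _ _ _ _ "(*)"] dual_sum_cong) auto
  then show ?thesis
    unfolding worst_case_error_sq[OF N_pos] sum_Pow_Suc upd increment_def by simp
qed

lemma sq_error_Suc: "d < s \<Longrightarrow> sq_error (d + 1) = sq_error d + increment d (z (d + 1))"
  using worst_case_error_upd_eq[of d "z (d + 1)"] worst_case_error_eq[of "d + 1"] by simp

lemma insert_subset_s: "d < s \<Longrightarrow> v \<subseteq> {1..d} \<Longrightarrow> insert (d + 1) v \<subseteq> {1..s}"
  by auto

lemma sq_error_nonneg: "d \<le> s \<Longrightarrow> sq_error d \<ge> 0"
  unfolding sq_error_def by (intro sum_nonneg mult_nonneg_nonneg dual_sum_nonneg less_imp_le[OF \<gamma>]) auto

lemma increment_nonneg: "d < s \<Longrightarrow> increment d c \<ge> 0"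
  unfolding increment_def
  by (intro sum_nonneg mult_nonneg_nonneg dual_sum_nonneg less_imp_le[OF \<gamma>] insert_subset_s) auto

text \<open>In the first step all units \<open>c\<close> give the same error, so that the choice \<open>z 1 = 1\<close> is
  minimal as well.\<close>

lemma increment_minimal:
  assumes d: "d < s" and c: "c \<in> reduced_candidates b m (w (d + 1))"
  shows "increment d (z (d + 1)) \<le> increment d c"
proof (cases "d = 0")
  case True
  have coprime: "coprime c (int (b ^ m))"
    using c unfolding reduced_candidates_def by (auto simp: coprime_iff_gcd_eq_1 split: if_splits)
  have z1: "z 1 = 1" using cbc by (simp add: reduced_cbc_def)
  \<comment> \<open>For \<open>d = 0\<close> only the support \<open>{1}\<close> occurs, and the
    unit \<open>c\<close> cancels from its congruence.\<close>
  have "int (b ^ m) dvd x * (int (b ^ w 1) * c) \<longleftrightarrow> int (b ^ m) dvd x * int (b ^ w 1)" for x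
    using coprime by (simp add: mult.assoc[symmetric] coprime_dvd_mult_left_iff coprime_commute)
  then have "dual_sum \<alpha> (b ^ m) {1} (zv(1 := int (b ^ w 1) * c)) = dual_sum \<alpha> (b ^ m) {1} (zv(1 := int (b ^ w 1) * 1))"
    by (simp add: dual_sum_def)
  then show ?thesis by (simp add: increment_def True z1)
next
  case False
  then have "d \<in> {1..<s}" using d by auto
  then have "is_arg_min (\<lambda>c. (worst_case_error (b ^ m) (d + 1) \<alpha> \<gamma> (reduced_vector b w (z(d + 1 := c))))\<^sup>2)
      (\<lambda>c. c \<in> reduced_candidates b m (w (d + 1))) (z (d + 1))"
    using cbc by (simp add: reduced_cbc_def)
  then show ?thesis using c unfolding worst_case_error_upd_eq[OF d] by (auto simp: is_arg_min_def not_less)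
qed

text \<open>Subadditivity is used twice: for the finite sum over \<open>v\<close>, and inside each
  dual sum, where it changes the exponent from \<alpha> to \<alpha> times \<lambda>.\<close>

lemma increment_powr_le:
  assumes d: "d < s" and l: "0 < l" "l \<le> 1" "\<alpha> * l > 1"
  shows "increment d c powr l \<le> (\<Sum>v\<in>Pow {1..d}. \<gamma> (insert (d + 1) v) powr l *
    dual_sum (\<alpha> * l) (b ^ m) (insert (d + 1) v) (zv(d + 1 := int (b ^ w (d + 1)) * c)))"
proof -
  have fin: "finite v" if "v \<subseteq> {1..d}" for v using that finite_subset by blast
  have pos: "\<gamma> (insert (d + 1) v) \<ge> 0" if "v \<subseteq> {1..d}" for v
    using \<gamma>[OF insert_subset_s[OF d that]] by simp
  have "increment d c powr l \<le> (\<Sum>v\<in>Pow {1..d}. (\<gamma> (insert (d + 1) v) *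
      dual_sum \<alpha> (b ^ m) (insert (d + 1) v) (zv(d + 1 := int (b ^ w (d + 1)) * c))) powr l)"
    unfolding increment_def using pos by (intro sum_powr_le_powr_sum l mult_nonneg_nonneg dual_sum_nonneg) auto
  also have "\<dots> \<le> (\<Sum>v\<in>Pow {1..d}. \<gamma> (insert (d + 1) v) powr l *
    dual_sum (\<alpha> * l) (b ^ m) (insert (d + 1) v) (zv(d + 1 := int (b ^ w (d + 1)) * c)))"
    using pos fin l
    by (intro sum_mono) (auto simp: powr_mult dual_sum_nonneg intro!: mult_left_mono dual_sum_powr_le)
  finally show ?thesis .
qed

text \<open>For \<open>w (d + 1) < m\<close> this is the averaged bound with
  \<open>Y = b ^ w (d + 1)\<close> and \<open>M = b ^ (m - w (d + 1))\<close>. Otherwise truncated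
  subtraction makes the denominator 1, and the bound without congruence fits, leaving the factor 2
  as slack.\<close>

lemma increment_bound:
  assumes d: "d < s" and l: "0 < l" "l \<le> 1" "\<alpha> * l > 1"
  shows "increment d (z (d + 1)) powr l \<le> (\<Sum>v\<in>Pow {1..d}. \<gamma> (insert (d + 1) v) powr l *
    (2 * (2 * zeta_real (\<alpha> * l)) ^ card (insert (d + 1) v) / real b ^ (m - w (d + 1))))" (is "_ \<le> ?B")
proof (cases "w (d + 1) < m")
  case False
  have "increment d (z (d + 1)) powr l \<le> (\<Sum>v\<in>Pow {1..d}. \<gamma> (insert (d + 1) v) powr l *
    dual_sum (\<alpha> * l) (b ^ m) (insert (d + 1) v) (zv(d + 1 := int (b ^ w (d + 1)) * z (d + 1))))"
    by (rule increment_powr_le[OF assms])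
  also have "\<dots> \<le> ?B"
  proof (intro sum_mono mult_left_mono)
    fix v assume "v \<in> Pow {1..d}"
    then have "finite (insert (d + 1) v)" using finite_subset by auto
    then have "dual_sum (\<alpha> * l) (b ^ m) (insert (d + 1) v) (zv(d + 1 := int (b ^ w (d + 1)) * z (d + 1)))
        \<le> (2 * zeta_real (\<alpha> * l)) ^ card (insert (d + 1) v)"
      by (rule dual_sum_le[OF l(3)])
    moreover have "0 \<le> (2 * zeta_real (\<alpha> * l)) ^ card (insert (d + 1) v)"
      using zeta_real_summable_pos(2)[OF l(3)] by simp
    ultimately show "dual_sum (\<alpha> * l) (b ^ m) (insert (d + 1) v) (zv(d + 1 := int (b ^ w (d + 1)) * z (d + 1)))
        \<le> 2 * (2 * zeta_real (\<alpha> * l)) ^ card (insert (d + 1) v) / real b ^ (m - w (d + 1))"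
      using False by simp
  qed simp
  finally show ?thesis .
next
  case True
  define k where "k = m - w (d + 1)"
  define Z where "Z = {c \<in> {1..int b ^ k - 1}. gcd c (int b ^ m) = 1}"
  have Z: "Z = reduced_candidates b m (w (d + 1))" using True by (simp add: Z_def k_def reduced_candidates_def)
  have k: "0 < k" "k \<le> m" using True by (auto simp: k_def)
  have M: "b ^ k > 0" using prime_b prime_gt_0_nat by simp
  have card_Z: "b ^ k \<le> 2 * card Z" unfolding Z_def by (rule card_coprime_int[OF prime_b k])
  then have "card Z > 0" using M by linarith
  let ?S = "\<lambda>v c. dual_sum (\<alpha> * l) (b ^ m) (insert (d + 1) v) (zv(d + 1 := int (b ^ w (d + 1)) * c))"
  have "real (card Z) * increment d (z (d + 1)) powr l = (\<Sum>c\<in>Z. increment d (z (d + 1)) powr l)" by simp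
  also have "\<dots> \<le> (\<Sum>c\<in>Z. \<Sum>v\<in>Pow {1..d}. \<gamma> (insert (d + 1) v) powr l * ?S v c)"
  proof (rule sum_mono)
    fix c assume "c \<in> Z"
    then have "increment d (z (d + 1)) powr l \<le> increment d c powr l"
      using l increment_nonneg[OF d] by (intro powr_mono2 increment_minimal d) (auto simp: Z)
    also have "\<dots> \<le> (\<Sum>v\<in>Pow {1..d}. \<gamma> (insert (d + 1) v) powr l * ?S v c)"
      by (rule increment_powr_le[OF assms])
    finally show "increment d (z (d + 1)) powr l \<le> (\<Sum>v\<in>Pow {1..d}. \<gamma> (insert (d + 1) v) powr l * ?S v c)" .
  qed
  also have "\<dots> = (\<Sum>v\<in>Pow {1..d}. \<gamma> (insert (d + 1) v) powr l * (\<Sum>c\<in>Z. ?S v c))"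
    by (subst sum.swap) (simp add: sum_distrib_left)
  also have "\<dots> \<le> (\<Sum>v\<in>Pow {1..d}. \<gamma> (insert (d + 1) v) powr l *
      (real (card Z) * (2 * (2 * zeta_real (\<alpha> * l)) ^ card (insert (d + 1) v) / real (b ^ k))))"
  proof (intro sum_mono mult_left_mono sum_dual_sum_le[OF l(3)])
    fix v assume v: "v \<in> Pow {1..d}"
    show "finite v" "d + 1 \<notin> v" using v finite_subset by auto
    show "b ^ m = b ^ w (d + 1) * b ^ k" using True by (simp add: k_def flip: power_add)
    show "coprime c (int (b ^ k))" if "c \<in> Z" for c
      using that k by (auto simp: Z_def coprime_iff_gcd_eq_1[symmetric])
    show "Z \<subseteq> {0..<int (b ^ k)}" by (auto simp: Z_def)
    show "int (b ^ k) \<le> 2 * int (card Z)" using card_Z by linarith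
  qed (use M prime_b prime_gt_0_nat in auto)
  also have "\<dots> = real (card Z) * ?B"
    by (simp add: sum_distrib_left mult_ac k_def)
  finally show ?thesis using \<open>card Z > 0\<close> by simp
qed

text \<open>Monotonicity of \<open>w\<close> enters here: the increment bound knows only
  \<open>w (d + 1)\<close>, whereas the exponent in the theorem is governed by the maximum over the
  whole set.\<close>

lemma MAX_insert_w:
  assumes "d < s" "v \<subseteq> {1..d}"
  shows "(MAX j\<in>insert (d + 1) v. w j) = w (d + 1)"
proof (rule Max_eqI)
  have "finite v" using assms(2) finite_subset by blast
  then show "finite (w ` insert (d + 1) v)" by simp
  fix y assume "y \<in> w ` insert (d + 1) v"
  then obtain j where j: "y = w j" "j = d + 1 \<or> j \<in> v" by auto
  then have "j \<in> {1..s}" "j \<le> d + 1" using assms by auto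
  then show "y \<le> w (d + 1)" using mono_onD[OF mono_w, of j "d + 1"] assms(1) j(1) by simp
qed simp

text \<open>Nonempty subsets of \<open>{1..d + 1}\<close> split according to whether they contain
  \<open>d + 1\<close>, in the error and in the bound alike. Starting from the empty sum at
  \<open>d = 0\<close> lets the first component be handled by the same step as all others.\<close>

theorem sq_error_powr_le:
  assumes l: "0 < l" "l \<le> 1" "\<alpha> * l > 1"
  shows "d \<le> s \<Longrightarrow> sq_error d powr l \<le> (\<Sum>u\<in>Pow {1..d} - {{}}.
    \<gamma> u powr l * (2 * (2 * zeta_real (\<alpha> * l)) ^ card u
      / real b ^ nat (max 0 (int m - int (MAX j\<in>u. w j)))))" (is "_ \<Longrightarrow> _ \<le> sum ?B _")
proof (induction d)
  case 0
  then show ?case by (simp add: sq_error_def)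
next
  case (Suc d)
  then have d: "d < s" by simp
  have "sq_error (Suc d) powr l = (sq_error d + increment d (z (d + 1))) powr l" using sq_error_Suc[OF d] by (simp only: Suc_eq_plus1)
  also have "\<dots> \<le> sq_error d powr l + increment d (z (d + 1)) powr l"
    using d by (intro powr_add_le l sq_error_nonneg increment_nonneg) auto
  also have "\<dots> \<le> sum ?B (Pow {1..d} - {{}}) + (\<Sum>v\<in>Pow {1..d}. ?B (insert (d + 1) v))"
  proof (rule add_mono)
    show "sq_error d powr l \<le> sum ?B (Pow {1..d} - {{}})" using Suc by simp
    have "?B (insert (d + 1) v) = \<gamma> (insert (d + 1) v) powr l *
        (2 * (2 * zeta_real (\<alpha> * l)) ^ card (insert (d + 1) v) / real b ^ (m - w (d + 1)))"
      if "v \<in> Pow {1..d}" for v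
    proof -
      have "nat (max 0 (int m - int (w (d + 1)))) = m - w (d + 1)" by linarith
      then show ?thesis using MAX_insert_w[OF d, of v] that by (simp only: Pow_iff)
    qed
    then have "(\<Sum>v\<in>Pow {1..d}. ?B (insert (d + 1) v)) = (\<Sum>v\<in>Pow {1..d}. \<gamma> (insert (d + 1) v) powr l *
        (2 * (2 * zeta_real (\<alpha> * l)) ^ card (insert (d + 1) v) / real b ^ (m - w (d + 1))))"
      by (rule sum.cong[OF refl])
    then show "increment d (z (d + 1)) powr l \<le> (\<Sum>v\<in>Pow {1..d}. ?B (insert (d + 1) v))"
      using increment_bound[OF d l] by (simp only:)
  qed
  also have "\<dots> = sum ?B (Pow {1..Suc d} - {{}})"
    unfolding Suc_eq_plus1 by (rule sum_Pow_Suc[symmetric])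
  finally show ?case .
qed

end

theorem theorem1:
  fixes b m N s :: nat
    and \<alpha> :: real
    and \<gamma> :: "nat set \<Rightarrow> real"
    and w :: "nat \<Rightarrow> nat"
    and z :: "nat \<Rightarrow> int"
  assumes "prime b"
    and "N = b ^ m"
    and "\<alpha> > 1"
    and "\<And>u. u \<subseteq> {1..s} \<Longrightarrow> \<gamma> u > 0"
    and "\<gamma> {} = 1"
    and "mono_on {1..s} w"
    and "reduced_cbc b m s \<alpha> \<gamma> w z"
  shows "\<forall>d\<in>{1..s}. \<forall>l\<in>{1 / \<alpha><..1}.
    (worst_case_error N d \<alpha> \<gamma> (reduced_vector b w z))\<^sup>2 \<le>
      (\<Sum>u\<in>Pow {1..d} - {{}}.
         \<gamma> u powr l * (2 * (2 * zeta_real (\<alpha> * l)) ^ card u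
           / real b ^ nat (max 0 (int m - int (MAX j\<in>u. w j))))) powr (1 / l)"
proof (intro ballI)
  fix d l assume d: "d \<in> {1..s}" and "l \<in> {1 / \<alpha><..1}"
  interpret reduced_construction b m s \<alpha> \<gamma> w z
    using assms by unfold_locales auto
  have l: "0 < l" "l \<le> 1" "\<alpha> * l > 1"
    using \<open>l \<in> {1 / \<alpha><..1}\<close> \<alpha> by (auto simp: field_simps intro: less_trans[of 0 "1 / \<alpha>"])
  have "d \<le> s" using d by simp
  \<comment> \<open>Undoing the \<lambda>-th power relies on \<open>sq_error d\<close> being
    nonnegative.\<close>
  have "(worst_case_error N d \<alpha> \<gamma> zv)\<^sup>2 = (sq_error d powr l) powr (1 / l)"
    using worst_case_error_eq[OF \<open>d \<le> s\<close>] sq_error_nonneg[OF \<open>d \<le> s\<close>] l assms(2) by (simp add: powr_powr)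
  also have "\<dots> \<le> (\<Sum>u\<in>Pow {1..d} - {{}}.
         \<gamma> u powr l * (2 * (2 * zeta_real (\<alpha> * l)) ^ card u
           / real b ^ nat (max 0 (int m - int (MAX j\<in>u. w j))))) powr (1 / l)"
    using l by (intro powr_mono2 sq_error_powr_le \<open>d \<le> s\<close>) auto
  finally show "(worst_case_error N d \<alpha> \<gamma> zv)\<^sup>2 \<le> (\<Sum>u\<in>Pow {1..d} - {{}}.
         \<gamma> u powr l * (2 * (2 * zeta_real (\<alpha> * l)) ^ card u
           / real b ^ nat (max 0 (int m - int (MAX j\<in>u. w j))))) powr (1 / l)" .
qed

end
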